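(* Let $\mathcal{U}^{F,n}_{D,Q,\mathcal{P}}=(\mathcal{U}^{A}_{D,Q,\mathcal{P}},\mathcal{U}^{R}_{D,Q,\mathcal{P}})$ be a kernel-type Chudnovsky$^2$ multiplication algorithm in $\mathbb{F}_{q^n}$, with basis $\mathcal{B}_{2D}=\mathcal{B}_D\cup\mathcal{B}_D^c$ of $\mathcal{L}(2D)$. Define the optimal scalar complexity of the $A$-part as $$\mu^{opti}_{s,0}(\mathcal{U}^{A}_{D,Q,\mathcal{P}}):=\min_{\sigma\in GL_{\mathbb{F}_q}(n)}\mu_{s,0}(\mathcal{U}^{A}_{\sigma(D),Q,\mathcal{P}}),$$ where $\mathcal{U}_{\sigma(D),Q,\mathcal{P}}$ is the algorithm obtained by using the basis $\sigma(\mathcal{B}_D)$ of $\mathcal{L}(D)$ and the basis $\mathcal{B}_Q=Ev_Q(\sigma(\mathcal{B}_D))$ of $F_Q$. Then this minimum is reached for $\{\mathcal{B}_{D,max},\mathcal{B}_Q\}$, where $\mathcal{B}_{D,max}$ is a basis of $\mathcal{L}(D)$ whose matrix $T_{D,max}$ (the matrix of $Ev_{\mathcal{P}}|_{\mathcal{L}(D)}$ in the basis $\mathcal{B}_{D,max}$ and the canonical basis) satisfies $$N_z(T_{D,max})=\max_{\sigma\in GL_{\mathbb{F}_q}(n)}N_z(T_{\sigma(D)}),$$ and $\mathcal{B}_Q=Ev_Q(\mathcal{B}_{D,max})$; and $$\mu^{opti}_{s,0}(\mathcal{U}^{A}_{D,Q,\mathcal{P}})=2\bigl(n(2n+g-1)-N_z(T_{D,max})\bigr).$$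 Moreover, relative to the basis $\mathcal{B}_{D,max}$ (i.e. with $\mathcal{B}_Q=Ev_Q(\mathcal{B}_{D,max})$ and $\mathcal{B}_{2D}=\mathcal{B}_{D,max}\cup\mathcal{B}_D^c$, the matrices $C$ and $T_{2D}$ being taken in these bases), the scalar complexity of the algorithm is $$\mu_{s,0}(\mathcal{U}^{F,n}_{D,Q,\mathcal{P}})=3n(2n+g-1)-\bigl(2N_z(T_{D,max})+N_z(T^{-1}_{2D,n})\bigr),$$ where $T^{-1}_{2D,n}$ denotes the matrix formed by the first $n$ rows of $T_{2D}^{-1}$.
   Context: Setting. $q$ is a prime power, $n\ge 1$ an integer, $F/\mathbb{F}_q$ an algebraic function field of genus $g$, $Q$ a place of $F/\mathbb{F}_q$ of degree $n$ with valuation ring $\mathcal{O}_Q$ and residue class field $F_Q=\mathcal{O}_Q/Q\cong\mathbb{F}_{q^n}$, $D$ a divisor of $F/\mathbb{F}_q$, and $\mathcal{P}=\{P_1,\dots,P_N\}$ an ordered set of distinct places of degree one. $\mathcal{L}(D)$ denotes the Riemann–Roch space of $D$. It is assumed that the support of $D$ contains none of $Q,P_1,\dots,P_N$, that $Ev_Q:\mathcal{L}(D)\to F_Q$, $f\mapsto f(Q)$, is surjective, and that $Ev_{\mathcal{P}}:\mathcal{L}(2D)\to\mathbb{F}_q^N$, $f\mapsto(f(P_1),\dots,f(P_N))$, is injective. In addition, $D$ is effective, $D-Q$ is a non-special divisor of degree $g-1$, and $N=|\mathcal{P}|=\dim\mathcal{L}(2D)$. Consequently $Ev_Q$ and $Ev_{\mathcal{P}}$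 are isomorphisms, $\mathcal{L}(D)\subseteq\mathcal{L}(2D)\subseteq\mathcal{O}_Q$, $\dim\mathcal{L}(D)=n$ and $N=2n+g-1$. Let $E_Q:\mathcal{O}_Q\to F_Q$ be the canonical projection. The Chudnovsky$^2$ multiplication algorithm $\mathcal{U}^{F,n}_{D,Q,\mathcal{P}}$ computes $xy=\mathcal{U}^R(\mathcal{U}^A(x)\odot\mathcal{U}^A(y))$ for $x,y\in F_Q$, with $\odot$ the coordinatewise product, $\mathcal{U}^{A}:=Ev_{\mathcal{P}}|_{\mathcal{L}(D)}\circ Ev_Q^{-1}$ and $\mathcal{U}^{R}:=E_Q|_{\mathcal{L}(2D)}\circ Ev_{\mathcal{P}}^{-1}$. Kernel-type: the algorithm is kernel-type if the (ordered) basis of $\mathcal{L}(2D)$ used is $\mathcal{B}_{2D}=\mathcal{B}_D\cup\mathcal{B}_D^c$, with first $n$ elements $\mathcal{B}_D=\{f_1,\dots,f_n\}$ a basis of $\mathcal{L}(D)$ and last $N-n$ elements $\mathcal{B}_D^c$ a basis of $\ker(E_Q|_{\mathcal{L}(2D)})$, which is a complement of $\mathcal{L}(D)$ in $\mathcal{L}(2D)$. Matrices. $\mathbb{F}_q^N$ has its canonical basis. $T_{2D}$ is the matrix of $Ev_{\mathcal{P}}$ in the basis $\mathcal{B}_{2D}$; $T_D$ is the matrix of the first $n$ columns of $T_{2D}$, i.e. the matrix of $Ev_{\mathcal{P}}|_{\mathcal{L}(D)}$ in the basis $\mathcal{B}_D$; $C$ is the matrix of $E_Q|_{\mathcal{L}(2D)}$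 in the bases $\mathcal{B}_{2D}$, $\mathcal{B}_Q$. $N_z(M)$ is the number of zero entries of a matrix $M$. For $\sigma=(\sigma_{ij})\in GL_{\mathbb{F}_q}(n)$, $\sigma(\mathcal{B}_D)$ is the basis with $j$-th element $\sum_i\sigma_{ij}f_i$, and $T_{\sigma(D)}$ is the matrix $T_D$ computed in the basis $\sigma(\mathcal{B}_D)$. Scalar complexities (counting only savings due to zero entries), for the algorithm with bases $\mathcal{B}_{2D}$ and $\mathcal{B}_Q=Ev_Q(\mathcal{B}_D)$: $\mu_{s,0}(\mathcal{U}^A)=2\bigl(n(2n+g-1)-N_z(T_D)\bigr)$, $\mu_{s,0}(\mathcal{U}^R)=n(2n+g-1)-N_z(C\,T_{2D}^{-1})$, and $\mu_{s,0}(\mathcal{U}^{F,n}_{D,Q,\mathcal{P}})=\mu_{s,0}(\mathcal{U}^A)+\mu_{s,0}(\mathcal{U}^R)$. *)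

theory Defs
  imports "HOL-Algebra.Finite_Extensions" "HOL-Algebra.Generated_Fields"
    "HOL-Algebra.Ideal_Product" "HOL-Algebra.Free_Abelian_Groups"
    "HOL-Library.Extended_Real" "Jordan_Normal_Form.Matrix"
begin

section \<open>Algebraic function fields\<close>

text \<open>A function field \<open>F/K\<close> is a field \<open>F\<close> together with a subfield \<open>K\<close> of \<open>F\<close>, given as a set.\<close>

definition function_field :: "('a, 'm) ring_scheme \<Rightarrow> 'a set \<Rightarrow> bool" where
  "function_field F K \<longleftrightarrow> field F \<and> subfield K F \<and>
     (\<exists>x\<in>carrier F. ring.transcendental F K x \<and>
        ring.finite_dimension F (generate_field F (insert x K)) (carrier F))"

definition vdim :: "('a, 'm) ring_scheme \<Rightarrow> 'a set \<Rightarrow> 'a set \<Rightarrow> nat" where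
  "vdim R K E = (if ring.finite_dimension R K E then ring.dim R K E else 0)"

definition ordered_basis :: "('a, 'm) ring_scheme \<Rightarrow> 'a set \<Rightarrow> 'a list \<Rightarrow> 'a set \<Rightarrow> bool" where
  "ordered_basis R K B E \<longleftrightarrow> ring.independent R K B \<and> ring.Span R K B = E"


section \<open>Places\<close>

definition valuation_ring :: "('a, 'm) ring_scheme \<Rightarrow> 'a set \<Rightarrow> 'a set \<Rightarrow> bool" where
  "valuation_ring F K V \<longleftrightarrow> subring V F \<and> K \<subset> V \<and> V \<subset> carrier F \<and>
     (\<forall>z\<in>carrier F - {\<zero>\<^bsub>F\<^esub>}. z \<in> V \<or> inv\<^bsub>F\<^esub> z \<in> V)"

definition place :: "('a, 'm) ring_scheme \<Rightarrow> 'a set \<Rightarrow> 'a set \<Rightarrow> bool" where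
  "place F K P \<longleftrightarrow> (\<exists>V. valuation_ring F K V \<and> maximalideal P (F\<lparr>carrier := V\<rparr>))"

text \<open>The ring \<open>\<O>\<^sub>P\<close>, which is uniquely determined by \<open>P\<close>.\<close>

definition place_ring :: "('a, 'm) ring_scheme \<Rightarrow> 'a set \<Rightarrow> 'a set \<Rightarrow> ('a, 'm) ring_scheme" where
  "place_ring F K P =
     F\<lparr>carrier := (THE V. valuation_ring F K V \<and> maximalideal P (F\<lparr>carrier := V\<rparr>))\<rparr>"

definition residue_field :: "('a, 'm) ring_scheme \<Rightarrow> 'a set \<Rightarrow> 'a set \<Rightarrow> 'a set ring" where
  "residue_field F K P = place_ring F K P Quot P"

text \<open>The canonical projection \<open>E\<^sub>P : \<O>\<^sub>P \<rightarrow> F\<^sub>P\<close>. It is meaningful only on \<open>\<O>\<^sub>P\<close>.\<close>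

definition residue :: "('a, 'm) ring_scheme \<Rightarrow> 'a set \<Rightarrow> 'a set \<Rightarrow> 'a \<Rightarrow> 'a set" where
  "residue F K P f = P +>\<^bsub>place_ring F K P\<^esub> f"

text \<open>The copy of the constant field \<open>K\<close> inside \<open>F\<^sub>P\<close>, over which \<open>F\<^sub>P\<close> is a vector space.\<close>

definition residue_constants :: "('a, 'm) ring_scheme \<Rightarrow> 'a set \<Rightarrow> 'a set \<Rightarrow> 'a set set" where
  "residue_constants F K P = residue F K P ` K"

definition place_degree :: "('a, 'm) ring_scheme \<Rightarrow> 'a set \<Rightarrow> 'a set \<Rightarrow> nat" where
  "place_degree F K P =
     vdim (residue_field F K P) (residue_constants F K P) (carrier (residue_field F K P))"

text \<open>The value \<open>f(P) \<in> K\<close> at a place \<open>P\<close> of degree one, where \<open>F\<^sub>P\<close> is identified with \<open>K\<close>.\<close>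

definition value_at :: "('a, 'm) ring_scheme \<Rightarrow> 'a set \<Rightarrow> 'a set \<Rightarrow> 'a \<Rightarrow> 'a" where
  "value_at F K P f = (THE a. a \<in> K \<and> residue F K P a = residue F K P f)"

primrec ideal_pow :: "('a, 'm) ring_scheme \<Rightarrow> 'a set \<Rightarrow> nat \<Rightarrow> 'a set" where
  "ideal_pow R I 0 = carrier R"
| "ideal_pow R I (Suc k) = ideal_prod R (ideal_pow R I k) I"

text \<open>
  The normalized discrete valuation of \<open>P\<close>: on \<open>\<O>\<^sub>P\<close> it is the largest \<open>k\<close> with \<open>z \<in> P\<^sup>k\<close>, and it is
  extended to \<open>F\<close> by \<open>v\<^sub>P(z) = -v\<^sub>P(1/z)\<close>. The supremum is attained for \<open>z \<noteq> 0\<close>, since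
  \<open>P\<^sup>k = t\<^sup>k \<O>\<^sub>P\<close> for a local parameter \<open>t\<close>, and it gives \<open>v\<^sub>P(0) = \<infinity>\<close>.
\<close>

definition valuation :: "('a, 'm) ring_scheme \<Rightarrow> 'a set \<Rightarrow> 'a set \<Rightarrow> 'a \<Rightarrow> ereal" where
  "valuation F K P z =
     (let R = place_ring F K P;
          ord = (\<lambda>y. SUP k\<in>{k. y \<in> ideal_pow R P k}. ereal (real k))
      in if z \<in> carrier R then ord z else - ord (inv\<^bsub>F\<^esub> z))"


section \<open>Divisors, Riemann-Roch spaces and the genus\<close>

abbreviation divisors :: "('a, 'm) ring_scheme \<Rightarrow> 'a set \<Rightarrow> ('a set \<Rightarrow>\<^sub>0 int) set" where
  "divisors F K \<equiv> carrier (free_Abelian_group {P. place F K P})"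

definition effective :: "('a set \<Rightarrow>\<^sub>0 int) \<Rightarrow> bool" where
  "effective A \<longleftrightarrow> (\<forall>P. 0 \<le> Poly_Mapping.lookup A P)"

definition divisor_degree :: "('a, 'm) ring_scheme \<Rightarrow> 'a set \<Rightarrow> ('a set \<Rightarrow>\<^sub>0 int) \<Rightarrow> int" where
  "divisor_degree F K A =
     (\<Sum>P\<in>Poly_Mapping.keys A. Poly_Mapping.lookup A P * int (place_degree F K P))"

definition RR_space :: "('a, 'm) ring_scheme \<Rightarrow> 'a set \<Rightarrow> ('a set \<Rightarrow>\<^sub>0 int) \<Rightarrow> 'a set" where
  "RR_space F K A = {f \<in> carrier F. f = \<zero>\<^bsub>F\<^esub> \<or>
     (\<forall>P. place F K P \<longrightarrow> ereal (real_of_int (- Poly_Mapping.lookup A P)) \<le> valuation F K P f)}"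

definition RR_dim :: "('a, 'm) ring_scheme \<Rightarrow> 'a set \<Rightarrow> ('a set \<Rightarrow>\<^sub>0 int) \<Rightarrow> nat" where
  "RR_dim F K A = vdim F K (RR_space F K A)"

text \<open>The genus is the maximum of \<open>deg A - dim L(A) + 1\<close> over all divisors \<open>A\<close>.\<close>

definition has_genus :: "('a, 'm) ring_scheme \<Rightarrow> 'a set \<Rightarrow> nat \<Rightarrow> bool" where
  "has_genus F K g \<longleftrightarrow>
     (\<exists>A\<in>divisors F K. divisor_degree F K A - int (RR_dim F K A) + 1 = int g) \<and>
     (\<forall>A\<in>divisors F K. divisor_degree F K A - int (RR_dim F K A) + 1 \<le> int g)"

definition speciality_index ::
    "('a, 'm) ring_scheme \<Rightarrow> 'a set \<Rightarrow> nat \<Rightarrow> ('a set \<Rightarrow>\<^sub>0 int) \<Rightarrow> int" where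
  "speciality_index F K g A = int (RR_dim F K A) - divisor_degree F K A + int g - 1"

definition nonspecial :: "('a, 'm) ring_scheme \<Rightarrow> 'a set \<Rightarrow> nat \<Rightarrow> ('a set \<Rightarrow>\<^sub>0 int) \<Rightarrow> bool" where
  "nonspecial F K g A \<longleftrightarrow> speciality_index F K g A = 0"


section \<open>Matrices over a ring with carrier\<close>

text \<open>
  Multiplication in \<open>Jordan_Normal_Form.Matrix\<close> is tied to type classes; the following operations
  take place in an arbitrary ring record \<open>R\<close>, below always the constant field \<open>F\<lparr>carrier := K\<rparr>\<close>.
\<close>

definition rmat_carrier :: "('a, 'm) ring_scheme \<Rightarrow> nat \<Rightarrow> nat \<Rightarrow> 'a mat set" where
  "rmat_carrier R r c = {A \<in> carrier_mat r c. elements_mat A \<subseteq> carrier R}"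

definition rmat_mult :: "('a, 'm) ring_scheme \<Rightarrow> 'a mat \<Rightarrow> 'a mat \<Rightarrow> 'a mat" where
  "rmat_mult R A B = mat (dim_row A) (dim_col B)
     (\<lambda>(i, j). \<Oplus>\<^bsub>R\<^esub>k\<in>{..<dim_col A}. A $$ (i, k) \<otimes>\<^bsub>R\<^esub> B $$ (k, j))"

definition rmat_one :: "('a, 'm) ring_scheme \<Rightarrow> nat \<Rightarrow> 'a mat" where
  "rmat_one R d = mat d d (\<lambda>(i, j). if i = j then \<one>\<^bsub>R\<^esub> else \<zero>\<^bsub>R\<^esub>)"

definition rmat_inverts :: "('a, 'm) ring_scheme \<Rightarrow> 'a mat \<Rightarrow> 'a mat \<Rightarrow> bool" where
  "rmat_inverts R A B \<longleftrightarrow> B \<in> rmat_carrier R (dim_row A) (dim_row A) \<and>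
     rmat_mult R A B = rmat_one R (dim_row A) \<and> rmat_mult R B A = rmat_one R (dim_row A)"

definition rmat_GL :: "('a, 'm) ring_scheme \<Rightarrow> nat \<Rightarrow> 'a mat set" where
  "rmat_GL R d = {A \<in> rmat_carrier R d d. \<exists>B. rmat_inverts R A B}"

definition rmat_inv :: "('a, 'm) ring_scheme \<Rightarrow> 'a mat \<Rightarrow> 'a mat" where
  "rmat_inv R A = (THE B. rmat_inverts R A B)"

definition N_z :: "('a, 'm) ring_scheme \<Rightarrow> 'a mat \<Rightarrow> nat" where
  "N_z R A = card {(i, j). i < dim_row A \<and> j < dim_col A \<and> A $$ (i, j) = \<zero>\<^bsub>R\<^esub>}"

definition first_rows :: "nat \<Rightarrow> 'a mat \<Rightarrow> 'a mat" where
  "first_rows r A = mat_of_rows (dim_col A) (take r (rows A))"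

text \<open>The basis \<open>\<sigma>(B)\<close>, whose \<open>j\<close>-th element is \<open>\<Sum>\<^sub>i \<sigma>\<^sub>i\<^sub>j B\<^sub>i\<close>.\<close>

definition basis_change :: "('a, 'm) ring_scheme \<Rightarrow> 'a mat \<Rightarrow> 'a list \<Rightarrow> 'a list" where
  "basis_change F \<sigma> B = map (\<lambda>c. ring.combine F (list_of_vec c) B) (cols \<sigma>)"


section \<open>The multiplication algorithm\<close>

text \<open>
  The evaluation \<open>Ev\<^sub>Q\<close> and the map \<open>E\<^sub>Q\<close> restricted to \<open>L(2D)\<close> are both given by \<open>residue F K Q\<close>.
  The ordered set of places of degree one is a distinct list \<open>Ps\<close>, so that \<open>N = length Ps\<close>.
\<close>

definition Ev :: "('a, 'm) ring_scheme \<Rightarrow> 'a set \<Rightarrow> 'a set list \<Rightarrow> 'a \<Rightarrow> 'a vec" where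
  "Ev F K Ps f = vec (length Ps) (\<lambda>i. value_at F K (Ps ! i) f)"

definition kernel_type ::
    "('a, 'm) ring_scheme \<Rightarrow> 'a set \<Rightarrow> nat \<Rightarrow> ('a set \<Rightarrow>\<^sub>0 int) \<Rightarrow> 'a set \<Rightarrow> 'a set list
      \<Rightarrow> 'a list \<Rightarrow> 'a list \<Rightarrow> bool" where
  "kernel_type F K n D Q Ps BD Bc \<longleftrightarrow>
     ordered_basis F K (BD @ Bc) (RR_space F K (frag_cmul 2 D)) \<and>
     length BD = n \<and> ordered_basis F K BD (RR_space F K D) \<and>
     length Bc = length Ps - n \<and>
     ordered_basis F K Bc
       {f \<in> RR_space F K (frag_cmul 2 D). residue F K Q f = \<zero>\<^bsub>residue_field F K Q\<^esub>}"

text \<open>Matrix of \<open>Ev\<^sub>\<P>\<close> on the span of \<open>B\<close>, in the basis \<open>B\<close> and the canonical basis of \<open>K\<^sup>N\<close>.\<close>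

definition T_mat :: "('a, 'm) ring_scheme \<Rightarrow> 'a set \<Rightarrow> 'a set list \<Rightarrow> 'a list \<Rightarrow> 'a mat" where
  "T_mat F K Ps B = mat_of_cols (length Ps) (map (Ev F K Ps) B)"

definition residue_coords ::
    "('a, 'm) ring_scheme \<Rightarrow> 'a set \<Rightarrow> 'a set \<Rightarrow> 'a set list \<Rightarrow> 'a set \<Rightarrow> 'a vec" where
  "residue_coords F K Q BQ x =
     (THE c. c \<in> carrier_vec (length BQ) \<and> set (list_of_vec c) \<subseteq> K \<and>
        x = ring.combine (residue_field F K Q) (map (residue F K Q) (list_of_vec c)) BQ)"

text \<open>Matrix of \<open>E\<^sub>Q\<close> on the span of \<open>B\<close>, in the bases \<open>B\<close> and \<open>BQ\<close>.\<close>

definition C_mat ::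
    "('a, 'm) ring_scheme \<Rightarrow> 'a set \<Rightarrow> 'a set \<Rightarrow> 'a list \<Rightarrow> 'a set list \<Rightarrow> 'a mat" where
  "C_mat F K Q B BQ =
     mat_of_cols (length BQ) (map (\<lambda>f. residue_coords F K Q BQ (residue F K Q f)) B)"

text \<open>
  Scalar complexities, counting only the savings due to zero entries. Here \<open>BD\<close> is a basis of
  \<open>L(D)\<close>, \<open>B2D\<close> one of \<open>L(2D)\<close> and \<open>BQ\<close> one of \<open>F\<^sub>Q\<close>. The formula for \<open>U\<^sup>A\<close> is the one for
  \<open>BQ = Ev\<^sub>Q(BD)\<close>: then \<open>Ev\<^sub>Q\<close> has the identity matrix on \<open>L(D)\<close>, and \<open>T\<^sub>D\<close> is the matrix of
  \<open>U\<^sup>A = Ev\<^sub>\<P> \<circ> Ev\<^sub>Q\<^sup>-\<^sup>1\<close>. Likewise \<open>C T\<^sub>2\<^sub>D\<^sup>-\<^sup>1\<close> is the matrix of \<open>U\<^sup>R = E\<^sub>Q \<circ> Ev\<^sub>\<P>\<^sup>-\<^sup>1\<close>.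
\<close>

definition mu_A ::
    "('a, 'm) ring_scheme \<Rightarrow> 'a set \<Rightarrow> nat \<Rightarrow> nat \<Rightarrow> 'a set list \<Rightarrow> 'a list \<Rightarrow> int" where
  "mu_A F K n g Ps BD =
     2 * (int n * (2 * int n + int g - 1) - int (N_z F (T_mat F K Ps BD)))"

definition mu_R ::
    "('a, 'm) ring_scheme \<Rightarrow> 'a set \<Rightarrow> nat \<Rightarrow> nat \<Rightarrow> 'a set \<Rightarrow> 'a set list
      \<Rightarrow> 'a list \<Rightarrow> 'a set list \<Rightarrow> int" where
  "mu_R F K n g Q Ps B2D BQ =
     int n * (2 * int n + int g - 1) -
     int (N_z F (rmat_mult (F\<lparr>carrier := K\<rparr>) (C_mat F K Q B2D BQ)
                   (rmat_inv (F\<lparr>carrier := K\<rparr>) (T_mat F K Ps B2D))))"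

definition mu_U ::
    "('a, 'm) ring_scheme \<Rightarrow> 'a set \<Rightarrow> nat \<Rightarrow> nat \<Rightarrow> 'a set \<Rightarrow> 'a set list
      \<Rightarrow> 'a list \<Rightarrow> 'a list \<Rightarrow> 'a set list \<Rightarrow> int" where
  "mu_U F K n g Q Ps BD Bc BQ = mu_A F K n g Ps BD + mu_R F K n g Q Ps (BD @ Bc) BQ"

definition mu_A_opti ::
    "('a, 'm) ring_scheme \<Rightarrow> 'a set \<Rightarrow> nat \<Rightarrow> nat \<Rightarrow> 'a set list \<Rightarrow> 'a list \<Rightarrow> int" where
  "mu_A_opti F K n g Ps BD =
     Min ((\<lambda>\<sigma>. mu_A F K n g Ps (basis_change F \<sigma> BD)) ` rmat_GL (F\<lparr>carrier := K\<rparr>) n)"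

definition N_z_max ::
    "('a, 'm) ring_scheme \<Rightarrow> 'a set \<Rightarrow> nat \<Rightarrow> 'a set list \<Rightarrow> 'a list \<Rightarrow> nat" where
  "N_z_max F K n Ps BD =
     Max ((\<lambda>\<sigma>. N_z F (T_mat F K Ps (basis_change F \<sigma> BD))) ` rmat_GL (F\<lparr>carrier := K\<rparr>) n)"

end

theory Submission
  imports Defs
begin

text \<open>
  The statement about the \<open>A\<close>-part is a translation between bases and invertible matrices. The
  bases of \<open>L(D)\<close> are exactly the \<open>\<sigma>(B\<^sub>D)\<close> with \<open>\<sigma> \<in> GL\<^sub>n(K)\<close> (lemmas \<open>basis_change_basis\<close> and
  \<open>basis_eq_basis_change\<close>), and there are finitely many of them because \<open>K\<close> is finite, so the
  largest number of zeros is attained. The complexity of the \<open>A\<close>-part is \<open>2 (c - N\<^sub>z)\<close> with a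
  constant \<open>c\<close>, hence it is minimal where \<open>N\<^sub>z\<close> is maximal.

  For the whole algorithm the point is that a kernel-type basis makes the matrix \<open>C\<close> trivial. Its
  first \<open>n\<close> columns are the coordinates of \<open>Ev\<^sub>Q(f\<^sub>j)\<close> in the basis \<open>Ev\<^sub>Q(B\<^sub>D)\<close>, that is, the unit
  vectors, and the other columns vanish since those basis elements lie in the kernel. So
  \<open>C = (I\<^sub>n | 0)\<close>, and \<open>C T\<^sup>-\<^sup>1\<close> consists of the first \<open>n\<close> rows of \<open>T\<^sup>-\<^sup>1\<close>. Replacing \<open>B\<^sub>D\<close> by another
  basis of \<open>L(D)\<close> keeps the basis of \<open>L(2D)\<close> kernel-type.

  Two facts make these matrices meaningful. Coordinates with respect to \<open>Ev\<^sub>Q(B\<^sub>D)\<close> are unique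
  because the residue map is injective on \<open>L(D)\<close>: its kernel in \<open>L(2D)\<close> is spanned by \<open>B\<^sub>D\<^sup>c\<close>, and
  \<open>B\<^sub>D \<union> B\<^sub>D\<^sup>c\<close> is independent. And \<open>T = T\<^sub>2\<^sub>D\<close> is invertible: it is square, and \<open>T U = T V\<close> says that
  \<open>Ev\<^sub>\<P>\<close> agrees on the families \<open>U(B)\<close> and \<open>V(B)\<close>, which then coincide by the
  injectivity of \<open>Ev\<^sub>\<P>\<close>, and \<open>U = V\<close> by the independence of \<open>B\<close>. Over a finite field such a left-cancellable matrix has an inverse, by counting
  (lemma \<open>left_cancellable_imp_invertible\<close>); this argument also yields the \<open>\<sigma>\<close> that connects two
  bases.

  All evaluations rest on \<open>L(2D) \<subseteq> \<O>\<^sub>P\<close> for the places \<open>P\<close> outside the support of \<open>D\<close>. This needs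
  that \<open>P\<close> determines its valuation ring and that \<open>v\<^sub>P\<close> is negative outside of \<open>\<O>\<^sub>P\<close>.
\<close>

section \<open>Matrices over a ring with carrier\<close>

lemma rmat_carrier_iff:
  "A \<in> rmat_carrier R r c \<longleftrightarrow>
     dim_row A = r \<and> dim_col A = c \<and> (\<forall>i<r. \<forall>j<c. A $$ (i, j) \<in> carrier R)"
  by (auto simp: rmat_carrier_def elements_mat_def UN_subset_iff image_subset_iff)

lemma finite_rmat_carrier:
  assumes "finite (carrier R)"
  shows "finite (rmat_carrier R r c)"
proof -
  have "rmat_carrier R r c \<subseteq> mat r c ` (({..<r} \<times> {..<c}) \<rightarrow>\<^sub>E carrier R)"
  proof
    fix A assume A: "A \<in> rmat_carrier R r c"
    define f where "f = restrict (\<lambda>p. A $$ p) ({..<r} \<times> {..<c})"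
    have "A = mat r c f"
      using A by (intro eq_matI) (auto simp: rmat_carrier_iff f_def)
    moreover have "f \<in> ({..<r} \<times> {..<c}) \<rightarrow>\<^sub>E carrier R"
      using A by (auto simp: rmat_carrier_iff f_def)
    ultimately show "A \<in> mat r c ` (({..<r} \<times> {..<c}) \<rightarrow>\<^sub>E carrier R)"
      by blast
  qed
  then show ?thesis
    by (rule finite_subset) (intro finite_imageI finite_PiE, auto simp: assms)
qed

lemma dim_rmat_mult [simp]:
  "dim_row (rmat_mult R A B) = dim_row A" "dim_col (rmat_mult R A B) = dim_col B"
  by (simp_all add: rmat_mult_def)

lemma rmat_mult_index:
  "i < dim_row A \<Longrightarrow> j < dim_col B \<Longrightarrow>
     rmat_mult R A B $$ (i, j) = (\<Oplus>\<^bsub>R\<^esub>k\<in>{..<dim_col A}. A $$ (i, k) \<otimes>\<^bsub>R\<^esub> B $$ (k, j))"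
  by (simp add: rmat_mult_def)

context ring
begin

lemma rmat_mult_closed:
  "A \<in> rmat_carrier R r s \<Longrightarrow> B \<in> rmat_carrier R s t \<Longrightarrow> rmat_mult R A B \<in> rmat_carrier R r t"
  by (auto simp: rmat_carrier_iff rmat_mult_index intro!: finsum_closed)

lemma rmat_one_closed: "rmat_one R d \<in> rmat_carrier R d d"
  by (auto simp: rmat_carrier_iff rmat_one_def)

lemma rmat_mult_assoc:
  assumes A: "A \<in> rmat_carrier R r s" and B: "B \<in> rmat_carrier R s t"
    and C: "C \<in> rmat_carrier R t u"
  shows "rmat_mult R (rmat_mult R A B) C = rmat_mult R A (rmat_mult R B C)"
proof (rule eq_matI)
  fix i j
  assume "i < dim_row (rmat_mult R A (rmat_mult R B C))"
    and "j < dim_col (rmat_mult R A (rmat_mult R B C))"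
  then have ij: "i < r" "j < u"
    using A C by (auto simp: rmat_carrier_iff)
  have a [simp]: "A $$ (i, l) \<in> carrier R" if "l < s" for l
    using A ij that by (auto simp: rmat_carrier_iff)
  have b [simp]: "B $$ (l, k) \<in> carrier R" if "l < s" "k < t" for l k
    using B that by (auto simp: rmat_carrier_iff)
  have c [simp]: "C $$ (k, j) \<in> carrier R" if "k < t" for k
    using C ij that by (auto simp: rmat_carrier_iff)
  have "rmat_mult R (rmat_mult R A B) C $$ (i, j) =
      (\<Oplus>k\<in>{..<t}. (\<Oplus>l\<in>{..<s}. A $$ (i, l) \<otimes> B $$ (l, k)) \<otimes> C $$ (k, j))"
    using A B C ij by (auto simp: rmat_carrier_iff rmat_mult_index intro!: finsum_cong')
  also have "\<dots> = (\<Oplus>k\<in>{..<t}. \<Oplus>l\<in>{..<s}. A $$ (i, l) \<otimes> B $$ (l, k) \<otimes> C $$ (k, j))"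
    by (intro finsum_cong' finsum_ldistr) (auto intro!: finsum_closed)
  also have "\<dots> = (\<Oplus>l\<in>{..<s}. \<Oplus>k\<in>{..<t}. A $$ (i, l) \<otimes> B $$ (l, k) \<otimes> C $$ (k, j))"
    by (intro finsum_finsum_swap) auto
  also have "\<dots> = (\<Oplus>l\<in>{..<s}. \<Oplus>k\<in>{..<t}. A $$ (i, l) \<otimes> (B $$ (l, k) \<otimes> C $$ (k, j)))"
    by (intro finsum_cong') (auto intro!: finsum_closed simp: m_assoc)
  also have "\<dots> = (\<Oplus>l\<in>{..<s}. A $$ (i, l) \<otimes> (\<Oplus>k\<in>{..<t}. B $$ (l, k) \<otimes> C $$ (k, j)))"
    by (intro finsum_cong' finsum_rdistr[symmetric]) (auto intro!: finsum_closed)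
  also have "\<dots> = rmat_mult R A (rmat_mult R B C) $$ (i, j)"
    using A B C ij
    by (auto simp: rmat_carrier_iff rmat_mult_index intro!: finsum_cong' finsum_closed)
  finally show "rmat_mult R (rmat_mult R A B) C $$ (i, j) =
      rmat_mult R A (rmat_mult R B C) $$ (i, j)" .
qed simp_all

lemma rmat_mult_one_left:
  assumes A: "A \<in> rmat_carrier R r c"
  shows "rmat_mult R (rmat_one R r) A = A"
proof (rule eq_matI)
  fix i j assume "i < dim_row A" "j < dim_col A"
  then have ij: "i < r" "j < c" using A by (auto simp: rmat_carrier_iff)
  have "rmat_mult R (rmat_one R r) A $$ (i, j) =
      (\<Oplus>k\<in>{..<r}. if i = k then A $$ (k, j) else \<zero>)"
    using A ij by (auto simp: rmat_carrier_iff rmat_mult_index rmat_one_def intro!: finsum_cong')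
  also have "\<dots> = A $$ (i, j)"
    using A ij by (intro finsum_singleton) (auto simp: rmat_carrier_iff)
  finally show "rmat_mult R (rmat_one R r) A $$ (i, j) = A $$ (i, j)" .
qed (use A in \<open>auto simp: rmat_carrier_iff rmat_one_def\<close>)

lemma rmat_mult_one_right:
  assumes A: "A \<in> rmat_carrier R r c"
  shows "rmat_mult R A (rmat_one R c) = A"
proof (rule eq_matI)
  fix i j assume "i < dim_row A" "j < dim_col A"
  then have ij: "i < r" "j < c" using A by (auto simp: rmat_carrier_iff)
  have "rmat_mult R A (rmat_one R c) $$ (i, j) =
      (\<Oplus>k\<in>{..<c}. if j = k then A $$ (i, k) else \<zero>)"
    using A ij by (auto simp: rmat_carrier_iff rmat_mult_index rmat_one_def intro!: finsum_cong')
  also have "\<dots> = A $$ (i, j)"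
    using A ij by (intro finsum_singleton) (auto simp: rmat_carrier_iff)
  finally show "rmat_mult R A (rmat_one R c) $$ (i, j) = A $$ (i, j)" .
qed (use A in \<open>auto simp: rmat_carrier_iff rmat_one_def\<close>)

text \<open>
  Inverses are unique by associativity, so the definite description in \<open>rmat_inv\<close> is met by any
  inverse.
\<close>

lemma rmat_inv_eq:
  assumes A: "A \<in> rmat_carrier R d d" and B: "rmat_inverts R A B"
  shows "rmat_inv R A = B"
  unfolding rmat_inv_def
proof (rule the_equality)
  fix C assume C: "rmat_inverts R A C"
  have "C = rmat_mult R C (rmat_mult R A B)"
    using A B C rmat_mult_one_right[of C d d] by (auto simp: rmat_inverts_def rmat_carrier_iff)
  also have "\<dots> = rmat_mult R (rmat_mult R C A) B"
    using A B C by (intro rmat_mult_assoc[symmetric]) (auto simp: rmat_inverts_def rmat_carrier_iff)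
  also have "\<dots> = B"
    using A B C rmat_mult_one_left[of B d d] by (auto simp: rmat_inverts_def rmat_carrier_iff)
  finally show "C = B" .
qed (fact B)

text \<open>
  Left multiplication by \<open>A\<close> is injective on the finite set of \<open>d \<times> d\<close> matrices, hence onto, and a
  preimage \<open>B\<close> of \<open>1\<close> is a right inverse. It is also a left inverse: \<open>A (B A) = A 1\<close>, and \<open>A\<close> cancels.
\<close>

lemma left_cancellable_imp_invertible:
  assumes fin: "finite (carrier R)" and A: "A \<in> rmat_carrier R d d"
    and cancel: "\<And>U V. U \<in> rmat_carrier R d d \<Longrightarrow> V \<in> rmat_carrier R d d \<Longrightarrow>
                   rmat_mult R A U = rmat_mult R A V \<Longrightarrow> U = V"
  shows "A \<in> rmat_GL R d"
proof -
  let ?M = "rmat_carrier R d d"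
  have "inj_on (rmat_mult R A) ?M"
    by (rule inj_onI) (rule cancel)
  moreover have "rmat_mult R A ` ?M \<subseteq> ?M"
    using rmat_mult_closed[OF A] by blast
  ultimately have "rmat_mult R A ` ?M = ?M"
    using endo_inj_surj[OF finite_rmat_carrier[OF fin]] by blast
  then obtain B where B: "B \<in> ?M" "rmat_mult R A B = rmat_one R d"
    using rmat_one_closed[of d] by (metis imageE)
  have "rmat_mult R A (rmat_mult R B A) = rmat_mult R (rmat_mult R A B) A"
    using rmat_mult_assoc[OF A B(1) A] by simp
  also have "\<dots> = rmat_mult R A (rmat_one R d)"
    using B(2) rmat_mult_one_left[OF A] rmat_mult_one_right[OF A] by simp
  finally have "rmat_mult R B A = rmat_one R d"
    by (rule cancel[OF rmat_mult_closed[OF B(1) A] rmat_one_closed])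
  with A B show ?thesis
    by (auto simp: rmat_GL_def rmat_inverts_def rmat_carrier_iff)
qed

lemma rmat_one_in_GL: "rmat_one R d \<in> rmat_GL R d"
  using rmat_one_closed[of d] rmat_mult_one_left[OF rmat_one_closed, of d]
  by (auto simp: rmat_GL_def rmat_inverts_def rmat_carrier_iff intro!: exI[of _ "rmat_one R d"])

text \<open>
  The matrices live over the constant field \<open>F\<lparr>carrier := K\<rparr>\<close>, whereas linear combinations of
  elements of a basis are formed in \<open>F\<close>. This lemma and the next two let products be computed in
  either ring.
\<close>

lemma finsum_subring:
  assumes H: "subring H R" and f: "f \<in> A \<rightarrow> H"
  shows "finsum (R\<lparr>carrier := H\<rparr>) f A = finsum R f A"
proof -
  interpret H: ring "R\<lparr>carrier := H\<rparr>"
    by (rule subring_is_ring[OF H])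
  have [simp]: "f a \<in> carrier R" if "f a \<in> H" for a
    using that subringE(1)[OF H] by blast
  show ?thesis
    using f
  proof (induction A rule: infinite_finite_induct)
    case (insert a A)
    then have *: "f a \<in> H" "f \<in> A \<rightarrow> H" "f \<in> A \<rightarrow> carrier R"
      using subringE(1)[OF H] by auto
    have "finsum (R\<lparr>carrier := H\<rparr>) f (insert a A) = f a \<oplus> finsum (R\<lparr>carrier := H\<rparr>) f A"
      using H.finsum_insert[of A a f] insert.hyps * by simp
    then show ?case
      using insert * by simp
  qed simp_all
qed

lemma rmat_mult_subring:
  assumes H: "subring H R"
    and A: "A \<in> rmat_carrier (R\<lparr>carrier := H\<rparr>) r s" and B: "B \<in> rmat_carrier (R\<lparr>carrier := H\<rparr>) s t"
  shows "rmat_mult (R\<lparr>carrier := H\<rparr>) A B = rmat_mult R A B"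
proof (rule eq_matI)
  fix i j assume "i < dim_row (rmat_mult R A B)" "j < dim_col (rmat_mult R A B)"
  then have "(\<lambda>k. A $$ (i, k) \<otimes> B $$ (k, j)) \<in> {..<dim_col A} \<rightarrow> H" "i < dim_row A" "j < dim_col B"
    using A B subringE(6)[OF H] by (auto simp: rmat_carrier_iff)
  then show "rmat_mult (R\<lparr>carrier := H\<rparr>) A B $$ (i, j) = rmat_mult R A B $$ (i, j)"
    using finsum_subring[OF H] by (simp add: rmat_mult_index)
qed simp_all

lemma rmat_carrier_subring:
  "subring H R \<Longrightarrow> A \<in> rmat_carrier (R\<lparr>carrier := H\<rparr>) r c \<Longrightarrow> A \<in> rmat_carrier R r c"
  using subringE(1) by (fastforce simp: rmat_carrier_iff)

end


section \<open>Linear combinations and change of basis\<close>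

lemma (in ring) combine_eq_finsum:
  assumes "length Ks = length Us" "set Ks \<subseteq> carrier R" "set Us \<subseteq> carrier R"
  shows "combine Ks Us = (\<Oplus>k\<in>{..<length Us}. Ks ! k \<otimes> Us ! k)"
  using assms
proof (induction Ks Us rule: rev_induct2)
  case (4 k Ks u Us)
  have cl: "Ks ! i \<otimes> Us ! i \<in> carrier R" if "i < length Us" for i
    using 4 that by (metis (no_types, lifting) butlast_snoc in_set_butlastD length_append_singleton
      m_closed nat.inject nth_mem subsetD)
  have "combine (Ks @ [k]) (Us @ [u]) = combine Ks Us \<oplus> (k \<otimes> u)"
    using 4 combine_append[of Ks Us "[k]" "[u]"] by simp
  also have "combine Ks Us = (\<Oplus>i\<in>{..<length Us}. Ks ! i \<otimes> Us ! i)"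
    using 4 by simp
  also have "\<dots> = (\<Oplus>i\<in>{..<length Us}. (Ks @ [k]) ! i \<otimes> (Us @ [u]) ! i)"
    using 4 cl by (intro finsum_cong') (auto simp: nth_append)
  finally show ?case
    using 4 cl
    by (simp add: lessThan_Suc nth_append a_comm Pi_def finsum_closed)
qed auto

lemma (in cring) rmat_mult_index_combine:
  assumes A: "A \<in> rmat_carrier R r s" and B: "B \<in> rmat_carrier R s t" and "i < r" "j < t"
  shows "rmat_mult R A B $$ (i, j) = combine (list_of_vec (col B j)) (list_of_vec (row A i))"
proof -
  have "set (list_of_vec (col B j)) \<subseteq> carrier R" "set (list_of_vec (row A i)) \<subseteq> carrier R"
    using assms by (auto simp: rmat_carrier_iff set_list_of_vec vec_set_def)
  then show ?thesis
    using assms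
    by (subst combine_eq_finsum)
       (auto simp: rmat_carrier_iff rmat_mult_index list_of_vec_index m_comm intro!: finsum_cong')
qed

text \<open>
  As a matrix with a single row, a family \<open>B\<close> turns the change of basis \<open>\<sigma>(B)\<close> into the matrix
  product \<open>B \<sigma>\<close>, so that composing changes of basis becomes the associativity of that product.
\<close>

definition row_mat :: "'a list \<Rightarrow> 'a mat" where
  "row_mat B = mat 1 (length B) (\<lambda>(i, j). B ! j)"

lemma row_mat_in_carrier: "set B \<subseteq> carrier R \<Longrightarrow> row_mat B \<in> rmat_carrier R 1 (length B)"
  by (auto simp: row_mat_def rmat_carrier_iff)

lemma row_mat_inject: "row_mat B = row_mat B' \<longleftrightarrow> B = B'"
proof
  assume eq: "row_mat B = row_mat B'"
  then have len: "length B = length B'"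
    by (metis dim_col_mat(1) row_mat_def)
  have "B ! j = B' ! j" if "j < length B" for j
    using arg_cong[OF eq, of "\<lambda>A. A $$ (0, j)"] that len by (simp add: row_mat_def)
  with len show "B = B'"
    by (simp add: nth_equalityI)
qed simp

lemma length_basis_change [simp]: "length (basis_change F \<sigma> B) = dim_col \<sigma>"
  by (simp add: basis_change_def)

lemma basis_change_nth:
  "j < dim_col \<sigma> \<Longrightarrow> basis_change F \<sigma> B ! j = ring.combine F (list_of_vec (col \<sigma> j)) B"
  by (simp add: basis_change_def)

context cring
begin

lemma basis_change_in_carrier:
  assumes "\<sigma> \<in> rmat_carrier R r c" "set B \<subseteq> carrier R"
  shows "set (basis_change R \<sigma> B) \<subseteq> carrier R"
  using assms
  by (auto simp: basis_change_def cols_def rmat_carrier_iff set_list_of_vec vec_set_def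
      intro!: combine_in_carrier)

lemma row_mat_basis_change:
  assumes \<sigma>: "\<sigma> \<in> rmat_carrier R (length B) c" and B: "set B \<subseteq> carrier R"
  shows "row_mat (basis_change R \<sigma> B) = rmat_mult R (row_mat B) \<sigma>"
proof (rule eq_matI)
  fix i j assume "i < dim_row (rmat_mult R (row_mat B) \<sigma>)" "j < dim_col (rmat_mult R (row_mat B) \<sigma>)"
  then have ij: "i = 0" "j < c" using \<sigma> by (auto simp: row_mat_def rmat_carrier_iff)
  have "list_of_vec (row (row_mat B) 0) = B"
    by (simp add: row_mat_def map_nth)
  then show "row_mat (basis_change R \<sigma> B) $$ (i, j) = rmat_mult R (row_mat B) \<sigma> $$ (i, j)"
    using ij \<sigma> rmat_mult_index_combine[OF row_mat_in_carrier[OF B] \<sigma>, of 0 j]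
    by (simp add: row_mat_def basis_change_nth rmat_carrier_iff)
qed (use \<sigma> in \<open>auto simp: row_mat_def\<close>)

lemma basis_change_mult:
  assumes \<sigma>: "\<sigma> \<in> rmat_carrier R (length B) s" and \<tau>: "\<tau> \<in> rmat_carrier R s t"
    and B: "set B \<subseteq> carrier R"
  shows "basis_change R (rmat_mult R \<sigma> \<tau>) B = basis_change R \<tau> (basis_change R \<sigma> B)"
proof -
  have len: "length (basis_change R \<sigma> B) = s"
    using \<sigma> by (simp add: rmat_carrier_iff)
  have "row_mat (basis_change R \<tau> (basis_change R \<sigma> B)) =
      rmat_mult R (rmat_mult R (row_mat B) \<sigma>) \<tau>"
    using row_mat_basis_change[OF _ basis_change_in_carrier[OF \<sigma> B]] row_mat_basis_change[OF \<sigma> B] \<tau> len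
    by simp
  also have "\<dots> = row_mat (basis_change R (rmat_mult R \<sigma> \<tau>) B)"
    using rmat_mult_assoc[OF row_mat_in_carrier[OF B] \<sigma> \<tau>]
      row_mat_basis_change[OF rmat_mult_closed[OF \<sigma> \<tau>] B] by simp
  finally show ?thesis
    by (simp add: row_mat_inject)
qed

lemma basis_change_one:
  assumes B: "set B \<subseteq> carrier R"
  shows "basis_change R (rmat_one R (length B)) B = B"
  using row_mat_basis_change[OF rmat_one_closed B] rmat_mult_one_right[OF row_mat_in_carrier[OF B]]
  by (simp add: row_mat_inject)

end

context field
begin

context
  fixes K assumes K: "subfield K R"
begin

lemma const_ring: "cring (R\<lparr>carrier := K\<rparr>)"
  using subring_is_domain[OF subfieldE(1)[OF K]] by (simp add: domain_def)

lemma list_of_vec_col_in_K: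
  "\<sigma> \<in> rmat_carrier (R\<lparr>carrier := K\<rparr>) r c \<Longrightarrow> j < c \<Longrightarrow>
     set (list_of_vec (col \<sigma> j)) \<subseteq> K \<and> length (list_of_vec (col \<sigma> j)) = r"
  by (auto simp: rmat_carrier_iff set_list_of_vec vec_set_def)

lemma independent_coordinates_unique:
  assumes ind: "independent K B" and "set Ks \<subseteq> K" "set Ls \<subseteq> K"
    and "length Ks = length B" "length Ls = length B" and "combine Ks B = combine Ls B"
  shows "Ks = Ls"
proof -
  have "combine Ks B \<in> Span K B"
    using Span_mem_iff_length_version[OF K independent_in_carrier[OF ind]] assms by blast
  from unique_decomposition[OF K ind this] assms show ?thesis
    by metis
qed

text \<open>
  Column by column, this is the uniqueness of coordinates. It is the form of independence that
  serves to cancel matrices.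
\<close>

lemma basis_change_inject:
  assumes ind: "independent K B"
    and U: "U \<in> rmat_carrier (R\<lparr>carrier := K\<rparr>) (length B) c"
    and V: "V \<in> rmat_carrier (R\<lparr>carrier := K\<rparr>) (length B) c"
    and eq: "basis_change R U B = basis_change R V B"
  shows "U = V"
proof (rule mat_col_eqI)
  fix j assume "j < dim_col V"
  then have j: "j < c" using V by (simp add: rmat_carrier_iff)
  then have "list_of_vec (col U j) = list_of_vec (col V j)"
    using U V arg_cong[OF eq, of "\<lambda>xs. xs ! j"] list_of_vec_col_in_K[OF U j] list_of_vec_col_in_K[OF V j]
    by (intro independent_coordinates_unique[OF ind])
       (simp_all add: basis_change_nth rmat_carrier_iff)
  then show "col U j = col V j"
    by (metis vec_list)
qed (use U V in \<open>auto simp: rmat_carrier_iff\<close>)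

lemma basis_change_in_Span:
  assumes B: "set B \<subseteq> carrier R" and U: "U \<in> rmat_carrier (R\<lparr>carrier := K\<rparr>) (length B) c"
  shows "set (basis_change R U B) \<subseteq> Span K B"
proof
  fix x assume "x \<in> set (basis_change R U B)"
  then obtain j where "j < c" "x = combine (list_of_vec (col U j)) B"
    using U by (auto simp: in_set_conv_nth basis_change_nth rmat_carrier_iff)
  then show "x \<in> Span K B"
    using list_of_vec_col_in_K[OF U] Span_mem_iff_length_version[OF K B] by blast
qed

text \<open>
  The columns of the matrix are coordinates of the elements of \<open>B'\<close>.
\<close>

lemma in_Span_imp_basis_change:
  assumes B: "set B \<subseteq> carrier R" and B': "set B' \<subseteq> Span K B"
  shows "\<exists>U\<in>rmat_carrier (R\<lparr>carrier := K\<rparr>) (length B) (length B'). B' = basis_change R U B"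
proof -
  have "\<exists>Ks. set Ks \<subseteq> K \<and> length Ks = length B \<and> x = combine Ks B" if "x \<in> set B'" for x
    using that B' Span_mem_iff_length_version[OF K B] by blast
  then obtain coords where coords:
    "\<And>x. x \<in> set B' \<Longrightarrow> set (coords x) \<subseteq> K \<and> length (coords x) = length B \<and> x = combine (coords x) B"
    by metis
  define U where "U = mat_of_cols (length B) (map (\<lambda>x. vec_of_list (coords x)) B')"
  have U: "U \<in> rmat_carrier (R\<lparr>carrier := K\<rparr>) (length B) (length B')"
    using coords
    by (auto simp: U_def rmat_carrier_iff mat_of_cols_index vec_of_list_index)
       (metis nth_mem subsetD)
  have "B' = basis_change R U B"
  proof (rule nth_equalityI)
    fix j assume j: "j < length B'"
    then have "col U j = vec_of_list (coords (B' ! j))"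
      using coords[of "B' ! j"] by (subst U_def, subst col_mat_of_cols)
        (auto intro!: carrier_vecI)
    then show "B' ! j = basis_change R U B ! j"
      using j coords[of "B' ! j"] by (simp add: basis_change_nth U_def list_vec)
  qed (simp add: U_def)
  with U show ?thesis by blast
qed

text \<open>
  The family \<open>\<sigma>(B)\<close> spans the same space because \<open>B = \<tau>(\<sigma>(B))\<close> for the inverse \<open>\<tau>\<close> of \<open>\<sigma>\<close>. It is
  independent because a relation with coefficients \<open>c\<close> gives the relation \<open>\<sigma> c\<close> for \<open>B\<close>; then
  \<open>\<sigma> c = 0\<close>, and \<open>c = \<tau> \<sigma> c = 0\<close>.
\<close>

lemma basis_change_basis:
  assumes B: "ordered_basis R K B E" and \<sigma>: "\<sigma> \<in> rmat_GL (R\<lparr>carrier := K\<rparr>) (length B)"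
  shows "ordered_basis R K (basis_change R \<sigma> B) E"
proof -
  interpret K: cring "R\<lparr>carrier := K\<rparr>" by (rule const_ring)
  let ?d = "length B" and ?M = "rmat_carrier (R\<lparr>carrier := K\<rparr>)"
  note sub = subfieldE(1)[OF K]
  have ind: "independent K B" and Bc: "set B \<subseteq> carrier R"
    using B independent_in_carrier by (auto simp: ordered_basis_def)
  obtain \<tau> where \<tau>: "rmat_inverts (R\<lparr>carrier := K\<rparr>) \<sigma> \<tau>" and \<sigma>': "\<sigma> \<in> ?M ?d ?d"
    using \<sigma> by (auto simp: rmat_GL_def)
  then have \<tau>': "\<tau> \<in> ?M ?d ?d"
    by (auto simp: rmat_inverts_def rmat_carrier_iff)
  let ?B = "basis_change R \<sigma> B"
  have B1: "set ?B \<subseteq> carrier R" "length ?B = ?d"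
    using basis_change_in_carrier[OF rmat_carrier_subring[OF sub \<sigma>'] Bc] \<sigma>' by (auto simp: rmat_carrier_iff)
  have one: "rmat_one (R\<lparr>carrier := K\<rparr>) ?d = rmat_one R ?d"
    unfolding rmat_one_def by (intro eq_matI) simp_all
  have "rmat_mult R \<sigma> \<tau> = rmat_one R ?d"
    using \<tau> \<sigma>' one rmat_mult_subring[OF sub \<sigma>' \<tau>'] by (simp add: rmat_inverts_def rmat_carrier_iff)
  then have undo: "basis_change R \<tau> ?B = B"
    using basis_change_mult[OF rmat_carrier_subring[OF sub \<sigma>'] rmat_carrier_subring[OF sub \<tau>'] Bc]
      basis_change_one[OF Bc] by simp
  have "Span K ?B \<subseteq> Span K B"
    by (rule mono_Span_subset[OF K basis_change_in_Span[OF Bc \<sigma>'] Bc])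
  moreover have "Span K B \<subseteq> Span K ?B"
    using mono_Span_subset[OF K _ B1(1), of B] basis_change_in_Span[OF B1(1), of \<tau>] \<tau>' B1(2) undo by simp
  ultimately have Sp: "Span K ?B = Span K B" by blast
  have "independent K ?B"
  proof (rule ccontr)
    assume "dependent K ?B"
    then obtain Ks where Ks: "length Ks = ?d" "combine Ks ?B = \<zero>" "set Ks \<subseteq> K" "set Ks \<noteq> {\<zero>}"
      using dependent_imp_non_trivial_combine[OF K B1(1)] B1(2) by metis
    \<comment> \<open>As one-column matrices, \<open>Ks\<close> and \<open>0\<close> are identified by \<open>basis_change _ ?B\<close>.\<close>
    define c where "c = mat_of_cols ?d [vec_of_list Ks]"
    define z where "z = mat_of_cols ?d [vec_of_list (replicate ?d \<zero>)]"
    have c: "c \<in> ?M ?d 1"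
      using Ks(1,3) nth_mem[of _ Ks] by (auto simp: c_def rmat_carrier_iff mat_of_cols_index vec_of_list_index)
    have z: "z \<in> ?M ?d 1"
      using subringE(2)[OF sub] by (auto simp: z_def rmat_carrier_iff mat_of_cols_index vec_of_list_index)
    have "col c 0 = vec_of_list Ks" "col z 0 = vec_of_list (replicate ?d \<zero>)"
      using Ks unfolding c_def z_def by (subst col_mat_of_cols; auto intro!: carrier_vecI)+
    then have eq: "basis_change R c ?B = basis_change R z ?B"
      using Ks combine_replicate[OF B1(1)] B1(2)
      by (intro nth_equalityI) (simp_all add: basis_change_nth c_def z_def list_vec)
    have "rmat_mult R \<sigma> c = rmat_mult R \<sigma> z"
    proof (rule basis_change_inject[OF ind])
      show "rmat_mult R \<sigma> c \<in> ?M ?d 1" "rmat_mult R \<sigma> z \<in> ?M ?d 1"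
        using K.rmat_mult_closed[OF \<sigma>'] c z rmat_mult_subring[OF sub \<sigma>'] by metis+
      show "basis_change R (rmat_mult R \<sigma> c) B = basis_change R (rmat_mult R \<sigma> z) B"
        using basis_change_mult[OF rmat_carrier_subring[OF sub \<sigma>'] rmat_carrier_subring[OF sub] Bc]
          c z eq by metis
    qed
    then have "rmat_mult (R\<lparr>carrier := K\<rparr>) \<tau> (rmat_mult (R\<lparr>carrier := K\<rparr>) \<sigma> c) =
        rmat_mult (R\<lparr>carrier := K\<rparr>) \<tau> (rmat_mult (R\<lparr>carrier := K\<rparr>) \<sigma> z)"
      using rmat_mult_subring[OF sub \<sigma>'] c z by metis
    then have "c = z"
      using \<tau> \<sigma>' K.rmat_mult_assoc[OF \<tau>' \<sigma>' c] K.rmat_mult_assoc[OF \<tau>' \<sigma>' z]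
        K.rmat_mult_one_left[OF c] K.rmat_mult_one_left[OF z]
      by (simp add: rmat_inverts_def rmat_carrier_iff)
    then have "Ks = replicate ?d \<zero>"
      using \<open>col c 0 = vec_of_list Ks\<close> \<open>col z 0 = vec_of_list (replicate ?d \<zero>)\<close> by (metis list_vec)
    then have "?d = 0"
      using Ks(4) by (cases ?d) auto
    then have "?B = []"
      using B1(2) by (metis length_0_conv)
    with \<open>dependent K ?B\<close> show False
      by (simp add: li_Nil)
  qed
  with Sp B show ?thesis by (simp add: ordered_basis_def)
qed

text \<open>
  The matrix \<open>\<sigma>\<close> of the coordinates of \<open>B'\<close> is left-cancellable: \<open>\<sigma> U = \<sigma> V\<close> gives
  \<open>U(B') = V(B')\<close>, and \<open>B'\<close> is independent.
\<close>

lemma basis_eq_basis_change: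
  assumes fin: "finite K" and B: "ordered_basis R K B E" and B': "ordered_basis R K B' E"
  shows "\<exists>\<sigma>\<in>rmat_GL (R\<lparr>carrier := K\<rparr>) (length B). B' = basis_change R \<sigma> B"
proof -
  interpret K: cring "R\<lparr>carrier := K\<rparr>" by (rule const_ring)
  let ?d = "length B" and ?M = "rmat_carrier (R\<lparr>carrier := K\<rparr>)"
  note sub = subfieldE(1)[OF K]
  have ind: "independent K B" "independent K B'"
    using B B' by (auto simp: ordered_basis_def)
  then have Bc: "set B \<subseteq> carrier R" "set B' \<subseteq> carrier R"
    using independent_in_carrier by auto
  have len: "length B' = ?d"
    using dimension_is_inj[OF K dimensionI[OF K ind(1)] dimensionI[OF K ind(2)]] B B'
    by (auto simp: ordered_basis_def)
  have "set B' \<subseteq> Span K B"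
    using Span_base_incl[OF K Bc(2)] B B' by (auto simp: ordered_basis_def)
  then obtain \<sigma> where \<sigma>: "\<sigma> \<in> ?M ?d ?d" "B' = basis_change R \<sigma> B"
    using in_Span_imp_basis_change[OF Bc(1)] len by metis
  have "\<sigma> \<in> rmat_GL (R\<lparr>carrier := K\<rparr>) ?d"
  proof (rule K.left_cancellable_imp_invertible)
    fix U V assume XY: "U \<in> ?M ?d ?d" "V \<in> ?M ?d ?d"
      "rmat_mult (R\<lparr>carrier := K\<rparr>) \<sigma> U = rmat_mult (R\<lparr>carrier := K\<rparr>) \<sigma> V"
    have "basis_change R Z B' = basis_change R (rmat_mult (R\<lparr>carrier := K\<rparr>) \<sigma> Z) B"
      if Z: "Z \<in> ?M ?d ?d" for Z
      using basis_change_mult[OF rmat_carrier_subring[OF sub \<sigma>(1)] rmat_carrier_subring[OF sub Z] Bc(1)]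
        rmat_mult_subring[OF sub \<sigma>(1) Z] \<sigma>(2) by simp
    with XY have "basis_change R U B' = basis_change R V B'"
      by simp
    with XY len show "U = V"
      by (intro basis_change_inject[OF ind(2)]) simp_all
  qed (use fin \<sigma> in simp_all)
  with \<sigma> show ?thesis by blast
qed

end

end


section \<open>Places and residue maps\<close>

text \<open>
  Hence a place determines its valuation ring. If \<open>y = 1/x\<close> is in \<open>P\<close>, then \<open>x\<close> cannot be in \<open>V\<close>, for
  \<open>1 = x y\<close> would be in \<open>P\<close>. Conversely, suppose that \<open>y \<notin> P\<close> and \<open>x \<notin> V\<close>, so \<open>y \<in> V\<close>. By
  maximality of \<open>P\<close> there are \<open>p \<in> P\<close> and \<open>v \<in> V\<close> with \<open>1 = p + v y\<close>, that is, \<open>x = p x + v\<close>. Therefore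
  \<open>p x \<notin> V\<close>, so \<open>1/(p x) \<in> V\<close>, and \<open>y = p \<cdot> 1/(p x)\<close> is in \<open>P\<close>, a contradiction.
\<close>

lemma (in field) mem_valuation_ring_iff:
  assumes V: "valuation_ring R K V" and P: "maximalideal P (R\<lparr>carrier := V\<rparr>)"
    and x: "x \<in> carrier R" "x \<noteq> \<zero>"
  shows "x \<in> V \<longleftrightarrow> inv x \<notin> P"
proof -
  have sub: "subring V R" using V by (simp add: valuation_ring_def)
  interpret V: cring "R\<lparr>carrier := V\<rparr>"
    using subring_is_domain[OF sub] by (simp add: domain_def)
  interpret P: maximalideal P "R\<lparr>carrier := V\<rparr>" by (rule P)
  note V_mult = subringE(6)[OF sub] and V_carr = subringE(1)[OF sub]
  have PV: "P \<subseteq> V" using P.a_subset by simp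
  have inv: "inv x \<in> carrier R" "x \<otimes> inv x = \<one>" "inv x \<otimes> x = \<one>" "inv x \<noteq> \<zero>"
    using x field_Units by (auto simp: Units_inv_closed Units_r_inv Units_l_inv)
  show ?thesis
  proof
    assume "x \<in> V"
    show "inv x \<notin> P"
    proof
      assume "inv x \<in> P"
      then have "\<one> \<in> P"
        using P.I_l_closed[of "inv x" x] \<open>x \<in> V\<close> inv by simp
      then show False
        using P.one_imp_carrier P.I_notcarr by simp
    qed
  next
    assume notP: "inv x \<notin> P"
    show "x \<in> V"
    proof (rule ccontr)
      assume notV: "x \<notin> V"
      define y where "y = inv x"
      have y: "y \<in> V" "y \<notin> P" "y \<in> carrier R"
        using V x notV notP inv by (auto simp: valuation_ring_def y_def)
      have xy: "x \<otimes> y = \<one>" "y \<otimes> x = \<one>" using inv by (simp_all add: y_def)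
      let ?J = "P <+>\<^bsub>R\<lparr>carrier := V\<rparr>\<^esub> (PIdl\<^bsub>R\<lparr>carrier := V\<rparr>\<^esub> y)"
      have J: "ideal ?J (R\<lparr>carrier := V\<rparr>)"
        using y by (intro V.add_ideals P.is_ideal V.cgenideal_ideal) simp
      have memJ: "p \<oplus> v \<otimes> y \<in> ?J" if "p \<in> P" "v \<in> V" for p v
        using that by (auto simp: set_add_def' cgenideal_def)
      have "p \<in> ?J" if "p \<in> P" for p
        using memJ[OF that, of \<zero>] PV V_carr that y subringE(2)[OF sub] by auto
      then have "P \<subseteq> ?J" by blast
      moreover have "y \<in> ?J"
        using memJ[of \<zero> \<one>] y P.zero_closed subringE(3)[OF sub] by auto
      moreover have "?J \<subseteq> V"
        using ideal.Icarr[OF J] by auto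
      ultimately have "?J = V"
        using P.I_maximal[OF J] y by auto
      then have "\<one> \<in> ?J" using subringE(3)[OF sub] by simp
      then obtain p v where pv: "p \<in> P" "v \<in> V" "\<one> = p \<oplus> v \<otimes> y"
        by (auto simp: set_add_def' cgenideal_def)
      then have pv': "p \<in> carrier R" "v \<in> carrier R" using PV V_carr by auto
      have "x = (p \<oplus> v \<otimes> y) \<otimes> x" using pv(3)[symmetric] x by simp
      also have "\<dots> = p \<otimes> x \<oplus> v" using pv' x y xy by (simp add: l_distr m_assoc)
      finally have x_eq: "x = p \<otimes> x \<oplus> v" .
      have px: "p \<otimes> x \<notin> V"
        using x_eq notV subringE(7)[OF sub] pv by metis
      then have "p \<otimes> x \<noteq> \<zero>" "p \<otimes> x \<in> carrier R" using subringE(2)[OF sub] pv' x by auto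
      then have w: "inv (p \<otimes> x) \<in> V" "inv (p \<otimes> x) \<otimes> (p \<otimes> x) = \<one>" "inv (p \<otimes> x) \<in> carrier R"
        using V px field_Units by (auto simp: valuation_ring_def Units_l_inv)
      have "inv (p \<otimes> x) \<otimes> p = inv (p \<otimes> x) \<otimes> p \<otimes> (x \<otimes> y)"
        using xy w pv' by simp
      also have "\<dots> = inv (p \<otimes> x) \<otimes> (p \<otimes> x) \<otimes> y"
        using w(3) pv' x y by (simp add: m_assoc)
      also have "\<dots> = y" using w y by simp
      finally have "y = inv (p \<otimes> x) \<otimes> p" by simp
      moreover have "inv (p \<otimes> x) \<otimes> p \<in> P"
        using P.I_l_closed[of p "inv (p \<otimes> x)"] pv w by simp
      ultimately show False using y by simp
    qed
  qed
qed

lemma (in ring) combine_subring: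
  assumes "subring H R"
  shows "ring.combine (R\<lparr>carrier := H\<rparr>) Ks Us = combine Ks Us"
proof -
  interpret H: ring "R\<lparr>carrier := H\<rparr>" by (rule subring_is_ring[OF assms])
  show ?thesis by (induction Ks Us rule: combine.induct) simp_all
qed

locale place_over_constants = field F for F (structure) +
  fixes K P
  assumes K: "subfield K F" and place: "place F K P"
begin

abbreviation "\<O> \<equiv> carrier (place_ring F K P)"

text \<open>
  The first equation lets the place ring be handled as a subring of \<open>F\<close>. As its left side recurs on
  its right side, it rewrites safely only from right to left.
\<close>

lemma place_ring_props:
  shows place_ring_eq: "place_ring F K P = F\<lparr>carrier := \<O>\<rparr>"
    and valuation_ring: "valuation_ring F K \<O>"
    and maximalideal: "maximalideal P (place_ring F K P)"
proof -
  obtain V where V: "valuation_ring F K V" "maximalideal P (F\<lparr>carrier := V\<rparr>)"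
    using place by (auto simp: place_def)
  have "W = V" if W: "valuation_ring F K W" "maximalideal P (F\<lparr>carrier := W\<rparr>)" for W
  proof -
    have sub: "W \<subseteq> carrier F" "V \<subseteq> carrier F" "\<zero> \<in> W" "\<zero> \<in> V"
      using V W subringE(2) by (auto simp: valuation_ring_def)
    have iff: "x \<in> W \<longleftrightarrow> x \<in> V" if "x \<in> carrier F" for x
      using that sub mem_valuation_ring_iff[OF V] mem_valuation_ring_iff[OF W] by (cases "x = \<zero>") simp_all
    show ?thesis
    proof (rule Set.set_eqI)
      fix x show "x \<in> W \<longleftrightarrow> x \<in> V"
        using iff[of x] sub(1,2) by (cases "x \<in> carrier F") auto
    qed
  qed
  note uniq = this
  have "(THE V. valuation_ring F K V \<and> maximalideal P (F\<lparr>carrier := V\<rparr>)) = V"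
    by (rule the_equality, intro conjI V, elim conjE, rule uniq)
  then have "place_ring F K P = F\<lparr>carrier := V\<rparr>"
    by (simp add: place_ring_def)
  with V show "place_ring F K P = F\<lparr>carrier := \<O>\<rparr>" "valuation_ring F K \<O>"
    "maximalideal P (place_ring F K P)"
    by simp_all
qed

lemma subring_O: "subring \<O> F"
  and K_subset_O: "K \<subseteq> \<O>"
  and O_subset: "\<O> \<subseteq> carrier F"
  using valuation_ring by (auto simp: valuation_ring_def)

sublocale O: domain "place_ring F K P"
  using subring_is_domain[OF subring_O] by (simp add: place_ring_eq[symmetric])

sublocale FP: field "residue_field F K P"
  unfolding residue_field_def by (rule maximalideal.quotient_is_field[OF maximalideal O.is_cring])

sublocale res: ring_hom_ring "place_ring F K P" "residue_field F K P" "residue F K P"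
  using ideal.rcos_ring_hom_ring[OF maximalideal.axioms(1)[OF maximalideal]]
  by (simp add: residue_field_def residue_def[abs_def])

lemma K_subfield_O: "subfield K (place_ring F K P)"
proof -
  have "field (F\<lparr>carrier := K\<rparr>)"
    using K subfield_iff(2) by blast
  then have "field ((place_ring F K P)\<lparr>carrier := K\<rparr>)"
    by (subst place_ring_eq) simp
  then show ?thesis
    using K_subset_O by (intro O.subfield_iff(1))
qed

lemma residue_inj_on_K: "inj_on (residue F K P) K"
  and residue_constants_subfield: "subfield (residue_constants F K P) (residue_field F K P)"
  using res.img_is_subfield[OF K_subfield_O] FP.one_not_zero by (simp_all add: residue_constants_def)

lemma residue_combine:
  assumes "set Ks \<subseteq> K" "set B \<subseteq> \<O>"
  shows "residue F K P (combine Ks B) =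
          FP.combine (map (residue F K P) Ks) (map (residue F K P) B)"
proof -
  have "set Ks \<subseteq> \<O>" using assms K_subset_O by blast
  moreover have "O.combine Ks B = combine Ks B"
    using combine_subring[OF subring_O] by (simp add: place_ring_eq[symmetric])
  ultimately show ?thesis
    using res.combine_hom[of Ks B] assms(2) by simp
qed

text \<open>
  If \<open>f \<notin> \<O>\<close>, then \<open>1/f \<in> P = \<O> P\<close>, so \<open>1/f\<close> has order at least \<open>1\<close>, and \<open>v\<^sub>P(f) \<le> -1\<close>.
\<close>

lemma mem_O_of_valuation_nonneg:
  assumes f: "f \<in> carrier F" "f \<noteq> \<zero>" and v: "0 \<le> valuation F K P f"
  shows "f \<in> \<O>"
proof (rule ccontr)
  assume notO: "f \<notin> \<O>"
  have "inv f \<in> P"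
    using mem_valuation_ring_iff[OF valuation_ring _ f] maximalideal notO
    by (simp add: place_ring_eq[symmetric])
  then have "\<one>\<^bsub>place_ring F K P\<^esub> \<otimes>\<^bsub>place_ring F K P\<^esub> inv f \<in>
      ideal_prod (place_ring F K P) \<O> P"
    by (intro ideal_prod.prod O.one_closed)
  moreover have "inv f \<in> \<O>"
    using valuation_ring f notO by (auto simp: valuation_ring_def)
  ultimately have "inv f \<in> ideal_pow (place_ring F K P) P 1"
    by simp
  then have "ereal (real 1) \<le> (SUP k\<in>{k. inv f \<in> ideal_pow (place_ring F K P) P k}. ereal (real k))"
    by (intro SUP_upper) simp
  then have "0 < (SUP k\<in>{k. inv f \<in> ideal_pow (place_ring F K P) P k}. ereal (real k))"
    by (rule less_le_trans[rotated]) simp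
  with v notO show False
    by (simp add: valuation_def Let_def)
qed

lemma RR_space_subset_O:
  assumes "P \<notin> Poly_Mapping.keys A"
  shows "RR_space F K A \<subseteq> \<O>"
proof
  fix f assume f: "f \<in> RR_space F K A"
  have "Poly_Mapping.lookup A P = 0"
    using assms by (simp add: in_keys_iff)
  moreover have "f = \<zero> \<or> ereal (real_of_int (- Poly_Mapping.lookup A P)) \<le> valuation F K P f"
    using f place unfolding RR_space_def by blast
  ultimately have "f = \<zero> \<or> 0 \<le> valuation F K P f"
    by (simp add: zero_ereal_def)
  then show "f \<in> \<O>"
    using mem_O_of_valuation_nonneg f subringE(2)[OF subring_O] by (auto simp: RR_space_def)
qed

lemma value_at_eqI:
  assumes "a \<in> K" "residue F K P a = residue F K P f"
  shows "value_at F K P f = a"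
  unfolding value_at_def using assms inj_onD[OF residue_inj_on_K] by (intro the_equality) auto

text \<open>
  A residue field of dimension one over the copy of \<open>K\<close> is spanned by its element \<open>1\<close>, so that every
  residue class contains a constant.
\<close>

lemma value_at_degree_one:
  assumes deg: "place_degree F K P = 1" and f: "f \<in> \<O>"
  shows value_at_in_K: "value_at F K P f \<in> K"
    and residue_value_at: "residue F K P (value_at F K P f) = residue F K P f"
proof -
  let ?k = "residue_constants F K P"
  note sub = residue_constants_subfield
  have "FP.finite_dimension ?k (carrier (residue_field F K P))"
    and "FP.dim ?k (carrier (residue_field F K P)) = 1"
    using deg by (simp_all add: place_degree_def vdim_def split: if_splits)
  then have "FP.dimension 1 ?k (carrier (residue_field F K P))"
    using FP.finite_dimensionE[OF sub] by (metis over_def)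
  moreover have "FP.independent ?k [\<one>\<^bsub>residue_field F K P\<^esub>]"
    by (auto intro!: FP.li_Cons FP.li_Nil)
  ultimately have "FP.Span ?k [\<one>\<^bsub>residue_field F K P\<^esub>] = carrier (residue_field F K P)"
    using FP.independent_length_eq_dimension[OF sub, of 1 _ "[\<one>\<^bsub>residue_field F K P\<^esub>]"] by simp
  moreover have "residue F K P f \<in> carrier (residue_field F K P)"
    using f by simp
  ultimately have "residue F K P f \<in> FP.Span ?k [\<one>\<^bsub>residue_field F K P\<^esub>]"
    by simp
  then obtain c where "c \<in> ?k" "residue F K P f = c \<otimes>\<^bsub>residue_field F K P\<^esub> \<one>\<^bsub>residue_field F K P\<^esub> \<oplus>\<^bsub>residue_field F K P\<^esub> \<zero>\<^bsub>residue_field F K P\<^esub>"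
    by (auto simp: FP.line_extension_mem_iff)
  moreover have "c \<in> carrier (residue_field F K P)"
    using \<open>c \<in> ?k\<close> subringE(1)[OF subfieldE(1)[OF sub]] by blast
  ultimately obtain a where "a \<in> K" "residue F K P a = residue F K P f"
    by (auto simp: residue_constants_def)
  with value_at_eqI[OF this] show "value_at F K P f \<in> K"
    "residue F K P (value_at F K P f) = residue F K P f"
    by simp_all
qed

text \<open>
  The value at \<open>P\<close> is the residue read in \<open>K\<close>; it inherits linearity from the residue map, which is
  injective on \<open>K\<close>.
\<close>

lemma value_at_combine:
  assumes deg: "place_degree F K P = 1" and Ks: "set Ks \<subseteq> K" and B: "set B \<subseteq> \<O>"
  shows "value_at F K P (combine Ks B) = combine Ks (map (value_at F K P) B)"
proof (rule value_at_eqI)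
  have vals: "set (map (value_at F K P) B) \<subseteq> K"
    using value_at_in_K[OF deg] B by auto
  interpret K: ring "F\<lparr>carrier := K\<rparr>"
    by (rule subring_is_ring[OF subfieldE(1)[OF K]])
  show "combine Ks (map (value_at F K P) B) \<in> K"
    using K.combine_in_carrier[of Ks "map (value_at F K P) B"] Ks vals
      combine_subring[OF subfieldE(1)[OF K]] by simp
  have "map (residue F K P) (map (value_at F K P) B) = map (residue F K P) B"
    using residue_value_at[OF deg] B by auto
  moreover have "set (map (value_at F K P) B) \<subseteq> \<O>"
    using vals K_subset_O by blast
  ultimately show "residue F K P (combine Ks (map (value_at F K P) B)) = residue F K P (combine Ks B)"
    using residue_combine[OF Ks B] residue_combine[OF Ks, of "map (value_at F K P) B"] by metis
qed

end


section \<open>The matrices of the multiplication algorithm\<close>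

lemma Ev_in_carrier_vec: "Ev F K Ps f \<in> carrier_vec (length Ps)"
  by (simp add: Ev_def)

lemma T_mat_index:
  "i < length Ps \<Longrightarrow> j < length B \<Longrightarrow> T_mat F K Ps B $$ (i, j) = value_at F K (Ps ! i) (B ! j)"
  by (simp add: T_mat_def Ev_def mat_of_cols_index)

lemma dim_T_mat [simp]: "dim_row (T_mat F K Ps B) = length Ps" "dim_col (T_mat F K Ps B) = length B"
  by (simp_all add: T_mat_def)

lemma T_mat_eq_iff: "T_mat F K Ps B = T_mat F K Ps B' \<longleftrightarrow> map (Ev F K Ps) B = map (Ev F K Ps) B'"
proof
  assume "T_mat F K Ps B = T_mat F K Ps B'"
  then have "cols (T_mat F K Ps B) = cols (T_mat F K Ps B')" by simp
  then show "map (Ev F K Ps) B = map (Ev F K Ps) B'"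
    using Ev_in_carrier_vec unfolding T_mat_def by (subst (asm) (1 2) cols_mat_of_cols) auto
qed (simp add: T_mat_def)

context field
begin

context
  fixes K Ps
  assumes K: "subfield K R"
    and Ps: "\<And>P. P \<in> set Ps \<Longrightarrow> place R K P \<and> place_degree R K P = 1"
begin

lemma T_mat_in_carrier:
  assumes B: "\<And>P. P \<in> set Ps \<Longrightarrow> set B \<subseteq> carrier (place_ring R K P)"
  shows "T_mat R K Ps B \<in> rmat_carrier (R\<lparr>carrier := K\<rparr>) (length Ps) (length B)"
proof -
  have "value_at R K (Ps ! i) (B ! j) \<in> K" if "i < length Ps" "j < length B" for i j
  proof -
    have mem: "Ps ! i \<in> set Ps" using that(1) by simp
    interpret place_over_constants R K "Ps ! i"
      by (intro place_over_constants.intro place_over_constants_axioms.intro field_axioms K)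
        (use Ps[OF mem] in simp)
    have "B ! j \<in> \<O>" using B[OF mem] that(2) by auto
    then show ?thesis
      using Ps[OF mem] by (intro value_at_in_K) simp_all
  qed
  then show ?thesis
    by (simp add: rmat_carrier_iff T_mat_index)
qed

text \<open>
  Entry by entry, this is the \<open>K\<close>-linearity of \<open>f \<mapsto> f(P\<^sub>i)\<close>.
\<close>

lemma T_mat_basis_change:
  assumes B: "\<And>P. P \<in> set Ps \<Longrightarrow> set B \<subseteq> carrier (place_ring R K P)"
    and Bc: "set B \<subseteq> carrier R"
    and \<sigma>: "\<sigma> \<in> rmat_carrier (R\<lparr>carrier := K\<rparr>) (length B) c"
  shows "T_mat R K Ps (basis_change R \<sigma> B) = rmat_mult (R\<lparr>carrier := K\<rparr>) (T_mat R K Ps B) \<sigma>"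
proof -
  note sub = subfieldE(1)[OF K]
  note T = T_mat_in_carrier[OF B]
  have "T_mat R K Ps (basis_change R \<sigma> B) = rmat_mult R (T_mat R K Ps B) \<sigma>"
  proof (rule eq_matI)
    fix i j
    assume "i < dim_row (rmat_mult R (T_mat R K Ps B) \<sigma>)" "j < dim_col (rmat_mult R (T_mat R K Ps B) \<sigma>)"
    then have ij: "i < length Ps" "j < c" "dim_col \<sigma> = c"
      using \<sigma> by (auto simp: rmat_carrier_iff)
    have mem: "Ps ! i \<in> set Ps" using ij by simp
    interpret place_over_constants R K "Ps ! i"
      by (intro place_over_constants.intro place_over_constants_axioms.intro field_axioms K)
        (use Ps[OF mem] in simp)
    have row: "list_of_vec (row (T_mat R K Ps B) i) = map (value_at R K (Ps ! i)) B"
      using ij by (intro nth_equalityI) (simp_all add: list_of_vec_index T_mat_index)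
    have "T_mat R K Ps (basis_change R \<sigma> B) $$ (i, j) =
        value_at R K (Ps ! i) (combine (list_of_vec (col \<sigma> j)) B)"
      using ij by (simp add: T_mat_index basis_change_nth)
    also have "\<dots> = combine (list_of_vec (col \<sigma> j)) (map (value_at R K (Ps ! i)) B)"
      using Ps[OF mem] B[OF mem] ij list_of_vec_col_in_K[OF K \<sigma>, of j]
      by (intro value_at_combine) simp_all
    also have "\<dots> = rmat_mult R (T_mat R K Ps B) \<sigma> $$ (i, j)"
      using rmat_mult_index_combine[OF rmat_carrier_subring[OF sub T] rmat_carrier_subring[OF sub \<sigma>]] ij row
      by simp
    finally show "T_mat R K Ps (basis_change R \<sigma> B) $$ (i, j) = rmat_mult R (T_mat R K Ps B) \<sigma> $$ (i, j)" .
  qed simp_all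
  then show ?thesis
    using rmat_mult_subring[OF sub T \<sigma>] by simp
qed

text \<open>
  Let \<open>T U = T V\<close>. Both sides are matrices of \<open>Ev\<^sub>\<P>\<close>, on the families \<open>U(B)\<close> and \<open>V(B)\<close>, so these
  families agree by injectivity, and \<open>U = V\<close> by independence of \<open>B\<close>. So \<open>T\<close> is left-cancellable.
\<close>

lemma T_mat_invertible:
  assumes fin: "finite K" and ind: "independent K B" and len: "length B = length Ps"
    and B: "\<And>P. P \<in> set Ps \<Longrightarrow> set B \<subseteq> carrier (place_ring R K P)"
    and inj: "inj_on (Ev R K Ps) (Span K B)"
  shows "T_mat R K Ps B \<in> rmat_GL (R\<lparr>carrier := K\<rparr>) (length B)"
proof -
  interpret K: cring "R\<lparr>carrier := K\<rparr>" by (rule const_ring[OF K])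
  note Bc = independent_in_carrier[OF ind]
  show ?thesis
  proof (rule K.left_cancellable_imp_invertible)
    fix U V
    assume U: "U \<in> rmat_carrier (R\<lparr>carrier := K\<rparr>) (length B) (length B)"
      and V: "V \<in> rmat_carrier (R\<lparr>carrier := K\<rparr>) (length B) (length B)"
      and eq: "rmat_mult (R\<lparr>carrier := K\<rparr>) (T_mat R K Ps B) U = rmat_mult (R\<lparr>carrier := K\<rparr>) (T_mat R K Ps B) V"
    have "map (Ev R K Ps) (basis_change R U B) = map (Ev R K Ps) (basis_change R V B)"
      using T_mat_basis_change[OF B Bc U] T_mat_basis_change[OF B Bc V] eq T_mat_eq_iff by metis
    moreover have "inj_on (Ev R K Ps) (set (basis_change R U B) \<union> set (basis_change R V B))"
      using basis_change_in_Span[OF K Bc U] basis_change_in_Span[OF K Bc V]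
      by (intro inj_on_subset[OF inj]) simp
    ultimately have "basis_change R U B = basis_change R V B"
      by (simp add: inj_on_map_eq_map)
    then show "U = V"
      by (rule basis_change_inject[OF K ind U V])
  qed (use fin T_mat_in_carrier[OF B] len in simp_all)
qed

end

end

text \<open>
  The left factor is the block matrix \<open>(I\<^sub>r | 0)\<close>.
\<close>

lemma (in ring) first_rows_eq_mult:
  assumes A: "A \<in> rmat_carrier R s t" and "r \<le> s"
  shows "rmat_mult R (mat r s (\<lambda>(i, j). if i = j then \<one> else \<zero>)) A = first_rows r A"
proof (rule eq_matI)
  fix i j assume "i < dim_row (first_rows r A)" "j < dim_col (first_rows r A)"
  then have ij: "i < r" "i < s" "j < t"
    using A assms(2) by (auto simp: first_rows_def rmat_carrier_iff)
  have "rmat_mult R (mat r s (\<lambda>(i, j). if i = j then \<one> else \<zero>)) A $$ (i, j) =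
      (\<Oplus>k\<in>{..<s}. if i = k then A $$ (k, j) else \<zero>)"
    using A ij by (auto simp: rmat_carrier_iff rmat_mult_index intro!: finsum_cong')
  also have "\<dots> = A $$ (i, j)"
    using A ij by (intro finsum_singleton) (auto simp: rmat_carrier_iff)
  also have "\<dots> = first_rows r A $$ (i, j)"
    using A ij by (simp add: first_rows_def mat_of_rows_index rmat_carrier_iff)
  finally show "rmat_mult R (mat r s (\<lambda>(i, j). if i = j then \<one> else \<zero>)) A $$ (i, j) =
      first_rows r A $$ (i, j)" .
qed (use assms in \<open>auto simp: first_rows_def rmat_carrier_iff\<close>)

context place_over_constants
begin

lemma zero_O: "\<zero>\<^bsub>place_ring F K P\<^esub> = \<zero>"
  by (subst place_ring_eq) simp

text \<open>
  The kernel of the residue map on the span of \<open>B\<close> is \<open>Span K B \<inter> Span K Bc\<close>, which is zero by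
  independence.
\<close>

lemma residue_inj_on_Span:
  assumes ind: "independent K (B @ Bc)" and O: "set (B @ Bc) \<subseteq> \<O>"
    and ker: "{f \<in> Span K (B @ Bc). residue F K P f = \<zero>\<^bsub>residue_field F K P\<^esub>} = Span K Bc"
  shows "inj_on (residue F K P) (Span K B)"
proof -
  have BO: "set B \<subseteq> \<O>" "set B \<subseteq> carrier F" "set Bc \<subseteq> carrier F"
    using O O_subset by auto
  have Sp: "O.Span K B = Span K B"
    using Span_consistent[OF subring_O] by (simp add: place_ring_eq[symmetric])
  have "Span K B \<subseteq> Span K (B @ Bc)"
    by (rule mono_Span_append(1)[OF K BO(2,3)])
  then have "{f \<in> Span K B. residue F K P f = \<zero>\<^bsub>residue_field F K P\<^esub>} \<subseteq> Span K B \<inter> Span K Bc"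
    using ker by blast
  also have "\<dots> = {\<zero>}"
    by (rule independent_split(3)[OF K ind])
  finally have "{f \<in> Span K B. residue F K P f = \<zero>\<^bsub>residue_field F K P\<^esub>} \<subseteq> {\<zero>}" .
  moreover have "\<zero> \<in> Span K B"
    using Span_subgroup_props(2)[OF K BO(2)] .
  moreover have "residue F K P \<zero> = \<zero>\<^bsub>residue_field F K P\<^esub>"
    using res.hom_zero zero_O by simp
  ultimately have "a_kernel ((place_ring F K P)\<lparr>carrier := O.Span K B\<rparr>) (residue_field F K P) (residue F K P) = {\<zero>\<^bsub>place_ring F K P\<^esub>}"
    unfolding zero_O a_kernel_def' Sp by auto
  then show ?thesis
    using res.inj_on_Span_iff_trivial_ker[OF K_subfield_O BO(1)] Sp by simp
qed

lemma residue_coords_eqI: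
  assumes ind: "independent K B" and O: "set B \<subseteq> \<O>" and inj: "inj_on (residue F K P) (Span K B)"
    and c: "c \<in> carrier_vec (length B)" "set (list_of_vec c) \<subseteq> K"
    and f: "residue F K P f = residue F K P (combine (list_of_vec c) B)"
  shows "residue_coords F K P (map (residue F K P) B) (residue F K P f) = c"
  unfolding residue_coords_def
proof (rule the_equality)
  show "c \<in> carrier_vec (length (map (residue F K P) B)) \<and> set (list_of_vec c) \<subseteq> K \<and>
      residue F K P f = FP.combine (map (residue F K P) (list_of_vec c)) (map (residue F K P) B)"
    using c f residue_combine[OF c(2) O] by simp
next
  fix d
  assume "d \<in> carrier_vec (length (map (residue F K P) B)) \<and> set (list_of_vec d) \<subseteq> K \<and>
      residue F K P f = FP.combine (map (residue F K P) (list_of_vec d)) (map (residue F K P) B)"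
  then have d: "d \<in> carrier_vec (length B)" "set (list_of_vec d) \<subseteq> K"
    and "residue F K P f = residue F K P (combine (list_of_vec d) B)"
    using residue_combine[OF _ O] by auto
  moreover have "combine (list_of_vec e) B \<in> Span K B"
    if "e \<in> carrier_vec (length B)" "set (list_of_vec e) \<subseteq> K" for e
    using Span_mem_iff_length_version[OF K independent_in_carrier[OF ind]] that
    by (metis carrier_vecD length_list_of_vec)
  ultimately have "combine (list_of_vec d) B = combine (list_of_vec c) B"
    using f c inj by (metis inj_onD)
  then have "list_of_vec d = list_of_vec c"
    using c d by (intro independent_coordinates_unique[OF K ind]) simp_all
  then show "d = c"
    by (metis vec_list)
qed

text \<open>
  The residue of the \<open>j\<close>-th element of \<open>B\<close> is the \<open>j\<close>-th element of the basis of the residue field,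
  and the residues of \<open>Bc\<close> vanish.
\<close>

lemma C_mat_kernel_type:
  assumes ind: "independent K (B @ Bc)" and O: "set (B @ Bc) \<subseteq> \<O>"
    and ker: "{f \<in> Span K (B @ Bc). residue F K P f = \<zero>\<^bsub>residue_field F K P\<^esub>} = Span K Bc"
  shows "C_mat F K P (B @ Bc) (map (residue F K P) B) =
           mat (length B) (length (B @ Bc)) (\<lambda>(i, j). if i = j then \<one> else \<zero>)"
proof (rule eq_matI)
  have BO: "set B \<subseteq> \<O>" "set B \<subseteq> carrier F" "set Bc \<subseteq> carrier F"
    using O O_subset by auto
  have indB: "independent K B"
    by (rule independent_split(2)[OF K ind])
  note coords = residue_coords_eqI[OF indB BO(1) residue_inj_on_Span[OF ind O ker]]
  have K01: "\<zero> \<in> K" "\<one> \<in> K"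
    using subringE(2,3)[OF subfieldE(1)[OF K]] .
  fix i j
  assume "i < dim_row (mat (length B) (length (B @ Bc)) (\<lambda>(i, j). if i = j then \<one> else \<zero>))"
    and "j < dim_col (mat (length B) (length (B @ Bc)) (\<lambda>(i, j). if i = j then \<one> else \<zero>))"
  then have ij: "i < length B" "j < length (B @ Bc)" by auto
  define c where "c = vec (length B) (\<lambda>i. if i = j then \<one> else \<zero>)"
  have c: "c \<in> carrier_vec (length B)" "set (list_of_vec c) \<subseteq> K"
    using K01 by (auto simp: c_def)
  have "residue F K P ((B @ Bc) ! j) = residue F K P (combine (list_of_vec c) B)"
  proof (cases "j < length B")
    case True
    then have "c = col (rmat_one F (length B)) j"
      by (auto simp: c_def rmat_one_def)
    then have "combine (list_of_vec c) B = basis_change F (rmat_one F (length B)) B ! j"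
      using True by (simp add: basis_change_nth rmat_one_def)
    then show ?thesis
      using True basis_change_one[OF BO(2)] by (simp add: nth_append)
  next
    case False
    then have "list_of_vec c = replicate (length B) \<zero>"
      by (intro nth_equalityI) (auto simp: c_def)
    then have "combine (list_of_vec c) B = \<zero>"
      using combine_replicate[OF BO(2)] by simp
    moreover have "(B @ Bc) ! j \<in> Span K Bc"
      using False ij Span_base_incl[OF K BO(3)] by (auto simp: nth_append)
    moreover have "\<zero> \<in> Span K Bc"
      using Span_subgroup_props(2)[OF K BO(3)] .
    ultimately show ?thesis
      using ker by auto
  qed
  from coords[OF c this] show "C_mat F K P (B @ Bc) (map (residue F K P) B) $$ (i, j) =
      mat (length B) (length (B @ Bc)) (\<lambda>(i, j). if i = j then \<one> else \<zero>) $$ (i, j)"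
    using ij by (auto simp: C_mat_def mat_of_cols_index c_def simp del: map_append)
qed (simp_all add: C_mat_def)

end


section \<open>Optimal bases\<close>

context field
begin

lemma finite_rmat_GL: "finite K \<Longrightarrow> finite (rmat_GL (R\<lparr>carrier := K\<rparr>) d)"
  by (rule finite_subset[OF _ finite_rmat_carrier[of "R\<lparr>carrier := K\<rparr>" d d]])
     (auto simp: rmat_GL_def)

lemma const_GL_nonempty:
  assumes K: "subfield K R"
  shows "rmat_GL (R\<lparr>carrier := K\<rparr>) d \<noteq> {}"
  using ring.rmat_one_in_GL[OF subring_is_ring[OF subfieldE(1)[OF K]]] by blast

lemma N_z_max_attained:
  assumes K: "subfield K R" and fin: "finite K" and B: "ordered_basis R K B E"
  shows "\<exists>B'. ordered_basis R K B' E \<and> N_z R (T_mat R K Ps B') = N_z_max R K (length B) Ps B"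
proof -
  have "N_z_max R K (length B) Ps B \<in>
      (\<lambda>\<sigma>. N_z R (T_mat R K Ps (basis_change R \<sigma> B))) ` rmat_GL (R\<lparr>carrier := K\<rparr>) (length B)"
    unfolding N_z_max_def using finite_rmat_GL[OF fin] const_GL_nonempty[OF K] by (intro Max_in) auto
  then show ?thesis
    using basis_change_basis[OF K B] by force
qed

text \<open>
  The complexity is a decreasing function of the number of zeros.
\<close>

lemma mu_A_opti_eq:
  assumes K: "subfield K R" and fin: "finite K"
  shows "mu_A_opti R K n g Ps B = 2 * (int n * (2 * int n + int g - 1) - int (N_z_max R K n Ps B))"
proof -
  define S where "S = (\<lambda>\<sigma>. N_z R (T_mat R K Ps (basis_change R \<sigma> B))) ` rmat_GL (R\<lparr>carrier := K\<rparr>) n"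
  define f where "f = (\<lambda>m::nat. 2 * (int n * (2 * int n + int g - 1) - int m))"
  have S: "finite S" "S \<noteq> {}"
    using finite_rmat_GL[OF fin] const_GL_nonempty[OF K] by (auto simp: S_def)
  have "mu_A_opti R K n g Ps B = Min (f ` S)"
    by (simp add: mu_A_opti_def mu_A_def S_def f_def image_image)
  also have "\<dots> = f (Max S)"
    using S Max_ge[OF S(1)] Max_in[OF S] by (intro Min_eqI) (auto simp: f_def)
  finally show ?thesis
    by (simp add: f_def S_def N_z_max_def)
qed

text \<open>
  So exchanging the basis of \<open>L(D)\<close> inside a kernel-type basis of \<open>L(2D)\<close> gives another one with the
  same complement.
\<close>

lemma independent_append_replace:
  assumes K: "subfield K R" and ind: "independent K (B @ C)"
    and B': "ordered_basis R K B' (Span K B)"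
  shows "independent K (B' @ C)" and "Span K (B' @ C) = Span K (B @ C)"
proof -
  note split = independent_split[OF K ind]
  have ind': "independent K B'" and Sp: "Span K B' = Span K B"
    using B' by (simp_all add: ordered_basis_def)
  show "independent K (B' @ C)"
    using independent_append[OF K ind' split(1)] split(3) Sp by simp
  show "Span K (B' @ C) = Span K (B @ C)"
    using Span_append_eq_set_add[OF K independent_in_carrier[OF ind'] independent_in_carrier[OF split(1)]]
      Span_append_eq_set_add[OF K independent_in_carrier[OF split(2)] independent_in_carrier[OF split(1)]]
      Sp by simp
qed

end

text \<open>
  The left side is the matrix \<open>C T\<^sup>-\<^sup>1\<close> of the reconstruction map \<open>U\<^sup>R\<close>, where \<open>C = (I | 0)\<close>.
\<close>

lemma (in place_over_constants) reconstruction_matrix_kernel_type: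
  assumes fin: "finite K" and ind: "independent K (B @ Bc)"
    and OP: "set (B @ Bc) \<subseteq> \<O>"
    and ker: "{f \<in> Span K (B @ Bc). residue F K P f = \<zero>\<^bsub>residue_field F K P\<^esub>} = Span K Bc"
    and Ps: "\<And>P'. P' \<in> set Ps \<Longrightarrow> place F K P' \<and> place_degree F K P' = 1"
    and OPs: "\<And>P'. P' \<in> set Ps \<Longrightarrow> set (B @ Bc) \<subseteq> carrier (place_ring F K P')"
    and len: "length (B @ Bc) = length Ps"
    and inj: "inj_on (Ev F K Ps) (Span K (B @ Bc))"
  shows "rmat_mult (F\<lparr>carrier := K\<rparr>) (C_mat F K P (B @ Bc) (map (residue F K P) B))
           (rmat_inv (F\<lparr>carrier := K\<rparr>) (T_mat F K Ps (B @ Bc))) =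
         first_rows (length B) (rmat_inv (F\<lparr>carrier := K\<rparr>) (T_mat F K Ps (B @ Bc)))"
proof -
  interpret K: cring "F\<lparr>carrier := K\<rparr>" by (rule const_ring[OF K])
  let ?T = "T_mat F K Ps (B @ Bc)" and ?N = "length (B @ Bc)"
  have "?T \<in> rmat_GL (F\<lparr>carrier := K\<rparr>) ?N"
    by (rule T_mat_invertible[OF K Ps fin ind len OPs inj])
  then obtain U where U: "rmat_inverts (F\<lparr>carrier := K\<rparr>) ?T U"
    and T: "?T \<in> rmat_carrier (F\<lparr>carrier := K\<rparr>) ?N ?N"
    by (auto simp: rmat_GL_def)
  have "rmat_inv (F\<lparr>carrier := K\<rparr>) ?T = U"
    by (rule K.rmat_inv_eq[OF T U])
  moreover have "U \<in> rmat_carrier (F\<lparr>carrier := K\<rparr>) ?N ?N"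
    using U len by (simp add: rmat_inverts_def)
  moreover have "C_mat F K P (B @ Bc) (map (residue F K P) B) = mat (length B) ?N
      (\<lambda>(i, j). if i = j then \<one>\<^bsub>F\<lparr>carrier := K\<rparr>\<^esub> else \<zero>\<^bsub>F\<lparr>carrier := K\<rparr>\<^esub>)"
    unfolding C_mat_kernel_type[OF ind OP ker] by (intro eq_matI) simp_all
  ultimately show ?thesis
    using K.first_rows_eq_mult[of U ?N ?N "length B"] by simp
qed

theorem proposition3p2:
  fixes F :: "('a, 'm) ring_scheme" and K :: "'a set" and q n g N :: nat
    and Q :: "'a set" and Ps :: "'a set list" and D :: "'a set \<Rightarrow>\<^sub>0 int"
    and BD Bc :: "'a list"
  assumes "function_field F K" and "finite K" and "card K = q"
    and "1 \<le> n"
    and "has_genus F K g"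
    and "place F K Q" and "place_degree F K Q = n"
    and "D \<in> divisors F K"
    and "distinct Ps" and "length Ps = N"
    and "\<And>P. P \<in> set Ps \<Longrightarrow> place F K P \<and> place_degree F K P = 1"
    and "Poly_Mapping.keys D \<inter> insert Q (set Ps) = {}"
    and "residue F K Q ` RR_space F K D = carrier (residue_field F K Q)"
    and "inj_on (Ev F K Ps) (RR_space F K (frag_cmul 2 D))"
    and "effective D"
    and "divisor_degree F K (D - frag_of Q) = int g - 1"
    and "nonspecial F K g (D - frag_of Q)"
    and "N = RR_dim F K (frag_cmul 2 D)"
    and "kernel_type F K n D Q Ps BD Bc"
  shows "(\<exists>Bmax. ordered_basis F K Bmax (RR_space F K D) \<and>
            N_z F (T_mat F K Ps Bmax) = N_z_max F K n Ps BD) \<and>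
         (\<forall>Bmax. ordered_basis F K Bmax (RR_space F K D) \<and>
            N_z F (T_mat F K Ps Bmax) = N_z_max F K n Ps BD \<longrightarrow>
              (\<exists>\<sigma>\<in>rmat_GL (F\<lparr>carrier := K\<rparr>) n. Bmax = basis_change F \<sigma> BD) \<and>
              mu_A F K n g Ps Bmax = mu_A_opti F K n g Ps BD \<and>
              mu_A_opti F K n g Ps BD =
                2 * (int n * (2 * int n + int g - 1) - int (N_z F (T_mat F K Ps Bmax))) \<and>
              mu_U F K n g Q Ps Bmax Bc (map (residue F K Q) Bmax) =
                3 * int n * (2 * int n + int g - 1) -
                (2 * int (N_z F (T_mat F K Ps Bmax)) +
                 int (N_z F (first_rows n
                   (rmat_inv (F\<lparr>carrier := K\<rparr>) (T_mat F K Ps (Bmax @ Bc)))))))"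
proof (intro conjI allI impI)
  have K: "subfield K F" and "field F"
    using assms(1) by (simp_all add: function_field_def)
  interpret field F by fact
  interpret Q: place_over_constants F K Q
    by (intro place_over_constants.intro place_over_constants_axioms.intro field_axioms K assms(6))
  note Ps = assms(11)
  have kt: "ordered_basis F K (BD @ Bc) (RR_space F K (frag_cmul 2 D))" "length BD = n"
    "ordered_basis F K BD (RR_space F K D)" "length Bc = length Ps - n"
    "ordered_basis F K Bc
       {f \<in> RR_space F K (frag_cmul 2 D). residue F K Q f = \<zero>\<^bsub>residue_field F K Q\<^esub>}"
    using assms(19) by (simp_all add: kernel_type_def)
  note ind = conjunct1[OF kt(1)[unfolded ordered_basis_def]]
    and L2D = conjunct2[OF kt(1)[unfolded ordered_basis_def]]
    and LD = conjunct2[OF kt(3)[unfolded ordered_basis_def]]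
    and ker = conjunct2[OF kt(5)[unfolded ordered_basis_def]]
  show "\<exists>Bmax. ordered_basis F K Bmax (RR_space F K D) \<and>
      N_z F (T_mat F K Ps Bmax) = N_z_max F K n Ps BD"
    using N_z_max_attained[OF K assms(2) kt(3)] kt(2) by simp
  fix Bmax
  assume "ordered_basis F K Bmax (RR_space F K D) \<and> N_z F (T_mat F K Ps Bmax) = N_z_max F K n Ps BD"
  then have Bmax: "ordered_basis F K Bmax (RR_space F K D)"
    and Nz: "N_z F (T_mat F K Ps Bmax) = N_z_max F K n Ps BD"
    by simp_all
  show \<sigma>: "\<exists>\<sigma>\<in>rmat_GL (F\<lparr>carrier := K\<rparr>) n. Bmax = basis_change F \<sigma> BD"
    using basis_eq_basis_change[OF K assms(2) kt(3) Bmax] kt(2) by simp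
  show opti: "mu_A_opti F K n g Ps BD =
      2 * (int n * (2 * int n + int g - 1) - int (N_z F (T_mat F K Ps Bmax)))"
    using mu_A_opti_eq[OF K assms(2)] Nz by simp
  then show "mu_A F K n g Ps Bmax = mu_A_opti F K n g Ps BD"
    by (simp add: mu_A_def)
  have lenmax: "length Bmax = n"
    using \<sigma> by (auto simp: rmat_GL_def rmat_carrier_iff)
  \<comment> \<open>Thus \<open>n + (N - n) = N\<close> for the truncated difference, and the matrix \<open>T\<^sub>2\<^sub>D\<close> is square.\<close>
  have "dimension (length (BD @ Bc)) K (RR_space F K (frag_cmul 2 D))"
    by (rule dimensionI[OF K ind L2D])
  then have "length (BD @ Bc) = N"
    using assms(18) finite_dimensionI dimI[OF K] by (simp add: RR_dim_def vdim_def over_def)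
  then have len: "length (Bmax @ Bc) = length Ps"
    using lenmax kt(2) assms(10) by simp
  have Bmax': "ordered_basis F K Bmax (Span K BD)"
    using Bmax LD by simp
  note ind' = independent_append_replace(1)[OF K ind Bmax']
  have Sp: "Span K (Bmax @ Bc) = RR_space F K (frag_cmul 2 D)"
    using independent_append_replace(2)[OF K ind Bmax'] L2D by simp
  \<comment> \<open>None of the places lies in the support of \<open>D\<close>, so \<open>L(2D)\<close> is contained in all their rings.\<close>
  have regular: "set (Bmax @ Bc) \<subseteq> carrier (place_ring F K P)" if "P \<in> insert Q (set Ps)" for P
  proof -
    interpret P: place_over_constants F K P
      by (intro place_over_constants.intro place_over_constants_axioms.intro field_axioms K)
         (use that Ps assms(6) in blast)
    have "P \<notin> Poly_Mapping.keys (frag_cmul 2 D)"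
      using that assms(12) by auto
    then show ?thesis
      using Span_base_incl[OF K independent_in_carrier[OF ind']] Sp P.RR_space_subset_O by blast
  qed
  have "mu_R F K n g Q Ps (Bmax @ Bc) (map (residue F K Q) Bmax) =
      int n * (2 * int n + int g - 1) -
      int (N_z F (first_rows n (rmat_inv (F\<lparr>carrier := K\<rparr>) (T_mat F K Ps (Bmax @ Bc)))))"
    unfolding mu_R_def
    using Q.reconstruction_matrix_kernel_type[OF assms(2) ind' _ _ Ps _ len] regular ker Sp assms(14) lenmax by simp
  then show "mu_U F K n g Q Ps Bmax Bc (map (residue F K Q) Bmax) =
      3 * int n * (2 * int n + int g - 1) -
      (2 * int (N_z F (T_mat F K Ps Bmax)) +
       int (N_z F (first_rows n (rmat_inv (F\<lparr>carrier := K\<rparr>) (T_mat F K Ps (Bmax @ Bc))))))"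
    by (simp add: mu_U_def mu_A_def algebra_simps)
qed

end
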